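(* Let $\Omega\subsetneq\mathbb{C}$ be a Jordan domain, let $G:\Omega\to\mathbb{C}$ be the generator of a semiflow $(\varphi_t)_{t\ge 0}$ of holomorphic self-maps of $\Omega$, and let $g:\Omega\to\mathbb{C}$ be holomorphic. Let $X$ be a Banach space of holomorphic or harmonic functions on $\Omega$ which is $(g,G)$-admissible, and let $\partial X$ be the boundary space corresponding to $X$, with trace isomorphism $\operatorname{Tr}:X\to\partial X$. Then the evolution problem associated with the Dirichlet-to-Robin operator $$ \begin{cases} \partial_t u-g\cdot u-G\cdot\partial_z u=0 & \text{on }(0,\infty)\times\partial\Omega,\\ -\Delta u=0 & \text{on }(0,\infty)\times\Omega,\\ u(0,\cdot)=u_0 & \text{on }\partial\Omega, \end{cases} $$ is well-posed in $\partial X$, and its solution is given by the trace of a weighted semigroup of composition operators: for $u_0\in\partial X$ and $v=\operatorname{Tr}^{-1}u_0\in X$, the solution on the boundary at time $t\ge 0$ is $$\operatorname{Tr}(m_t\cdot (v\circ\varphi_t)),\qquad m_t(z)=\exp\left(\int_0^t g(\varphi_s(z))\,ds\right)\quad(z\in\Omega).$$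
   Context: A semiflow of holomorphic functions on $\Omega$ is a family $(\varphi_t)_{t\ge0}$ of holomorphic maps $\varphi_t:\Omega\to\Omega$ with $\varphi_0(z)=z$, $\varphi_{s+t}(z)=\varphi_s(\varphi_t(z))$ for all $s,t>0$, and $\varphi_t(z)\to z$ as $t\to0^+$, for every $z\in\Omega$. Its generator is $G(z)=\lim_{t\to0^+}\frac{\varphi_t(z)-z}{t}$. $\mathcal{H}(\Omega,\mathbb{C})$ and $h(\Omega,\mathbb{C})$ denote the spaces of complex-valued holomorphic, respectively harmonic, functions on $\Omega$; $\mathbb{H}(\Omega,\mathbb{C})$ denotes either of them. Given $G$, $(\varphi_t)_t$ and holomorphic $g:\Omega\to\mathbb{C}$, put $m_t(z)=\exp\left(\int_0^t g(\varphi_s(z))\,ds\right)$ and $S_tf=m_t\cdot(f\circ\varphi_t)$ for $t\ge 0$. A Banach space $X\subset\mathbb{H}(\Omega,\mathbb{C})$ is called $(g,G)$-admissible if (i) $S_tX\subset X$ for all $t\ge0$, and (ii) $(S_t)_{t\ge0}$ is strongly continuous on $X$. In this case $\Gamma$ denotes the generator of the semigroup $(S_t)_{t\ge 0}$ on $X$; it acts as $\Gamma f=g\cdot f+G\cdot f'$ for $f\in\operatorname{dom}\Gamma$, where $G\cdot f'$ is, for harmonic $f$, read as the derivative of $f$ in the direction $G$ (also written $G\cdot\nabla f$). Boundary space: let $k:\Omega\to\mathbb{D}$ be any conformal map onto the unit disk and, for $f\in X$ and $0<r<1$, let $f_r(z)=f(k^{-1}(rk(z)))$. Suppose every $f\in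 X$ has a uniquely defined boundary distribution $f^*$ on $\partial\Omega$, i.e. $\lim_{r\to1^-}\int_{\partial\Omega}f_r(x)\phi(x)\,dx=\langle f^*,\phi\rangle$ for every $\phi\in C^\infty(\partial\Omega)$. Let $\partial X$ be the set of all these boundary values. If there is an isomorphism $\operatorname{Tr}:X\to\partial X$ (the trace, $\operatorname{Tr}f=f^*$), then $\partial X$ is called the boundary space corresponding to $X$; it is normed by $\|f^*\|_{\partial X}=\|f\|_X$. The Dirichlet-to-Robin operator $\mathfrak{D}_{\mathcal R}:\operatorname{dom}(\mathfrak{D}_{\mathcal R})\subset\partial X\to\partial X$ sends $u_0=\operatorname{Tr}u$, with $u\in\operatorname{dom}\Gamma$, to the boundary value of $g\cdot u+G\cdot u'$, i.e. $\mathfrak{D}_{\mathcal R}u_0=\operatorname{Tr}(g\cdot u+G\cdot u')$. The evolution problem is understood as the abstract Cauchy problem $\frac{d}{dt}u(t)=\mathfrak{D}_{\mathcal R}u(t)$, $u(0)=u_0$, in $\partial X$ (the values of $u$ inside $\Omega$ being $\operatorname{Tr}^{-1}u(t)$); well-posedness in $\partial X$ means that this operator generates a strongly continuous semigroup on $\partial X$, whose orbits are the solutions. *)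

theory Defs
  imports "HOL-Complex_Analysis.Complex_Analysis"
begin

section \<open>Normed function spaces and strongly continuous semigroups\<close>

text \<open>
  Function spaces are sets \<open>V\<close> of functions \<open>'b \<Rightarrow> complex\<close> with pointwise operations, normed by a
  function \<open>N\<close> that is relevant on \<open>V\<close> only. This covers functions on a domain
  (\<open>'b = complex\<close>) as well as distributions (\<open>'b\<close> the type of the test functions).
\<close>

definition complex_subspace :: "('b \<Rightarrow> complex) set \<Rightarrow> bool" where
  "complex_subspace V \<longleftrightarrow>
     (\<lambda>_. 0) \<in> V \<and>
     (\<forall>f\<in>V. \<forall>h\<in>V. (\<lambda>x. f x + h x) \<in> V) \<and>
     (\<forall>c. \<forall>f\<in>V. (\<lambda>x. c * f x) \<in> V)"

definition norm_on :: "('b \<Rightarrow> complex) set \<Rightarrow> (('b \<Rightarrow> complex) \<Rightarrow> real) \<Rightarrow> bool" where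
  "norm_on V N \<longleftrightarrow>
     (\<forall>f\<in>V. 0 \<le> N f \<and> (N f = 0 \<longleftrightarrow> f = (\<lambda>_. 0))) \<and>
     (\<forall>f\<in>V. \<forall>h\<in>V. N (\<lambda>x. f x + h x) \<le> N f + N h) \<and>
     (\<forall>c. \<forall>f\<in>V. N (\<lambda>x. c * f x) = cmod c * N f)"

definition banach_on :: "('b \<Rightarrow> complex) set \<Rightarrow> (('b \<Rightarrow> complex) \<Rightarrow> real) \<Rightarrow> bool" where
  "banach_on V N \<longleftrightarrow>
     complex_subspace V \<and> norm_on V N \<and>
     (\<forall>F :: nat \<Rightarrow> 'b \<Rightarrow> complex.
        (\<forall>n. F n \<in> V) \<and>
        (\<forall>e>0. \<exists>M. \<forall>m\<ge>M. \<forall>n\<ge>M. N (\<lambda>x. F m x - F n x) < e) \<longrightarrow>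
        (\<exists>f\<in>V. (\<lambda>n. N (\<lambda>x. F n x - f x)) \<longlonglongrightarrow> 0))"

definition bounded_operator_on ::
    "('b \<Rightarrow> complex) set \<Rightarrow> (('b \<Rightarrow> complex) \<Rightarrow> real) \<Rightarrow> (('b \<Rightarrow> complex) \<Rightarrow> 'b \<Rightarrow> complex) \<Rightarrow> bool"
  where
  "bounded_operator_on V N A \<longleftrightarrow>
     (\<forall>f\<in>V. A f \<in> V) \<and>
     (\<forall>f\<in>V. \<forall>h\<in>V. A (\<lambda>x. f x + h x) = (\<lambda>x. A f x + A h x)) \<and>
     (\<forall>c. \<forall>f\<in>V. A (\<lambda>x. c * f x) = (\<lambda>x. c * A f x)) \<and>
     (\<exists>C. \<forall>f\<in>V. N (A f) \<le> C * N f)"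

definition strongly_continuous_on ::
    "('b \<Rightarrow> complex) set \<Rightarrow> (('b \<Rightarrow> complex) \<Rightarrow> real) \<Rightarrow>
     (real \<Rightarrow> ('b \<Rightarrow> complex) \<Rightarrow> 'b \<Rightarrow> complex) \<Rightarrow> bool" where
  "strongly_continuous_on V N T \<longleftrightarrow>
     (\<forall>t\<ge>0. bounded_operator_on V N (T t)) \<and>
     (\<forall>f\<in>V. ((\<lambda>t. N (\<lambda>x. T t f x - f x)) \<longlongrightarrow> 0) (at_right 0))"

definition C0_semigroup ::
    "('b \<Rightarrow> complex) set \<Rightarrow> (('b \<Rightarrow> complex) \<Rightarrow> real) \<Rightarrow>
     (real \<Rightarrow> ('b \<Rightarrow> complex) \<Rightarrow> 'b \<Rightarrow> complex) \<Rightarrow> bool" where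
  "C0_semigroup V N T \<longleftrightarrow>
     strongly_continuous_on V N T \<and>
     (\<forall>f\<in>V. T 0 f = f) \<and>
     (\<forall>s\<ge>0. \<forall>t\<ge>0. \<forall>f\<in>V. T (s + t) f = T s (T t f))"

text \<open>\<open>generator_graph V N T f h\<close>: \<open>f\<close> lies in the domain of the generator of \<open>T\<close>, with value \<open>h\<close>.\<close>

definition generator_graph ::
    "('b \<Rightarrow> complex) set \<Rightarrow> (('b \<Rightarrow> complex) \<Rightarrow> real) \<Rightarrow>
     (real \<Rightarrow> ('b \<Rightarrow> complex) \<Rightarrow> 'b \<Rightarrow> complex) \<Rightarrow> ('b \<Rightarrow> complex) \<Rightarrow> ('b \<Rightarrow> complex) \<Rightarrow> bool" where
  "generator_graph V N T f h \<longleftrightarrow>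
     f \<in> V \<and> h \<in> V \<and>
     ((\<lambda>t. N (\<lambda>x. (T t f x - f x) / of_real t - h x)) \<longlongrightarrow> 0) (at_right 0)"

definition generator_dom ::
    "('b \<Rightarrow> complex) set \<Rightarrow> (('b \<Rightarrow> complex) \<Rightarrow> real) \<Rightarrow>
     (real \<Rightarrow> ('b \<Rightarrow> complex) \<Rightarrow> 'b \<Rightarrow> complex) \<Rightarrow> ('b \<Rightarrow> complex) set" where
  "generator_dom V N T = {f. \<exists>h. generator_graph V N T f h}"

text \<open>The operator \<open>A\<close> with domain exactly \<open>D\<close> is the generator of the semigroup \<open>T\<close>.\<close>

definition generates ::
    "('b \<Rightarrow> complex) set \<Rightarrow> (('b \<Rightarrow> complex) \<Rightarrow> real) \<Rightarrow> ('b \<Rightarrow> complex) set \<Rightarrow>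
     (('b \<Rightarrow> complex) \<Rightarrow> 'b \<Rightarrow> complex) \<Rightarrow>
     (real \<Rightarrow> ('b \<Rightarrow> complex) \<Rightarrow> 'b \<Rightarrow> complex) \<Rightarrow> bool" where
  "generates V N D A T \<longleftrightarrow>
     C0_semigroup V N T \<and>
     (\<forall>f h. generator_graph V N T f h \<longleftrightarrow> f \<in> D \<and> h = A f)"

text \<open>\<open>u' = A u\<close> on \<open>[0, \<infinity>)\<close> and \<open>u 0 = u\<^sub>0\<close>, the derivative being taken in the norm of the space.\<close>

definition classical_solution ::
    "(('b \<Rightarrow> complex) \<Rightarrow> real) \<Rightarrow> ('b \<Rightarrow> complex) set \<Rightarrow>
     (('b \<Rightarrow> complex) \<Rightarrow> 'b \<Rightarrow> complex) \<Rightarrow> ('b \<Rightarrow> complex) \<Rightarrow> (real \<Rightarrow> 'b \<Rightarrow> complex) \<Rightarrow> bool" where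
  "classical_solution N D A u\<^sub>0 u \<longleftrightarrow>
     u 0 = u\<^sub>0 \<and>
     (\<forall>t\<ge>0. u t \<in> D \<and>
        ((\<lambda>s. N (\<lambda>x. (u s x - u t x) / of_real (s - t) - A (u t) x)) \<longlongrightarrow> 0) (at t within {0..}))"

text \<open>
  The abstract Cauchy problem for \<open>A\<close> is well-posed with solution semigroup \<open>T\<close>: \<open>A\<close> generates \<open>T\<close>,
  and the orbits of \<open>T\<close> are the solutions. For \<open>u\<^sub>0 \<in> D\<close> the orbit is the only classical solution;
  for general \<open>u\<^sub>0\<close> the solution is by convention the orbit.
\<close>

definition well_posed_with ::
    "('b \<Rightarrow> complex) set \<Rightarrow> (('b \<Rightarrow> complex) \<Rightarrow> real) \<Rightarrow> ('b \<Rightarrow> complex) set \<Rightarrow>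
     (('b \<Rightarrow> complex) \<Rightarrow> 'b \<Rightarrow> complex) \<Rightarrow>
     (real \<Rightarrow> ('b \<Rightarrow> complex) \<Rightarrow> 'b \<Rightarrow> complex) \<Rightarrow> bool" where
  "well_posed_with V N D A T \<longleftrightarrow>
     banach_on V N \<and> generates V N D A T \<and>
     (\<forall>u\<^sub>0\<in>D. \<forall>u. classical_solution N D A u\<^sub>0 u \<longleftrightarrow> (\<forall>t\<ge>0. u t = T t u\<^sub>0))"


section \<open>Smooth and harmonic functions\<close>

text \<open>Real differentiability classes on an open set of the plane, by means of the partial
  derivatives in the directions \<open>1\<close> and \<open>\<i>\<close>.\<close>

primrec Ck_on :: "nat \<Rightarrow> (complex \<Rightarrow> complex) \<Rightarrow> complex set \<Rightarrow> bool" where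
  "Ck_on 0 f S \<longleftrightarrow> continuous_on S f"
| "Ck_on (Suc n) f S \<longleftrightarrow>
     f differentiable_on S \<and>
     Ck_on n (\<lambda>z. frechet_derivative f (at z) 1) S \<and>
     Ck_on n (\<lambda>z. frechet_derivative f (at z) \<i>) S"

definition smooth_on :: "(complex \<Rightarrow> complex) \<Rightarrow> complex set \<Rightarrow> bool" where
  "smooth_on f S \<longleftrightarrow> (\<forall>n. Ck_on n f S)"

definition laplacian :: "(complex \<Rightarrow> complex) \<Rightarrow> complex \<Rightarrow> complex" where
  "laplacian f z =
     frechet_derivative (\<lambda>w. frechet_derivative f (at w) 1) (at z) 1 +
     frechet_derivative (\<lambda>w. frechet_derivative f (at w) \<i>) (at z) \<i>"

definition harmonic_on :: "(complex \<Rightarrow> complex) \<Rightarrow> complex set \<Rightarrow> bool" where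
  "harmonic_on f S \<longleftrightarrow> Ck_on 2 f S \<and> (\<forall>z\<in>S. laplacian f z = 0)"


section \<open>Semiflows and weighted composition semigroups\<close>

definition jordan_domain :: "complex set \<Rightarrow> bool" where
  "jordan_domain \<Omega> \<longleftrightarrow>
     (\<exists>\<gamma>. simple_path \<gamma> \<and> pathfinish \<gamma> = pathstart \<gamma> \<and> \<Omega> = inside (path_image \<gamma>))"

definition holomorphic_semiflow :: "complex set \<Rightarrow> (real \<Rightarrow> complex \<Rightarrow> complex) \<Rightarrow> bool" where
  "holomorphic_semiflow \<Omega> \<phi> \<longleftrightarrow>
     (\<forall>t\<ge>0. \<phi> t holomorphic_on \<Omega> \<and> \<phi> t ` \<Omega> \<subseteq> \<Omega>) \<and>
     (\<forall>z\<in>\<Omega>. \<phi> 0 z = z) \<and>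
     (\<forall>s>0. \<forall>t>0. \<forall>z\<in>\<Omega>. \<phi> (s + t) z = \<phi> s (\<phi> t z)) \<and>
     (\<forall>z\<in>\<Omega>. ((\<lambda>t. \<phi> t z) \<longlongrightarrow> z) (at_right 0))"

definition semiflow_generator ::
    "complex set \<Rightarrow> (real \<Rightarrow> complex \<Rightarrow> complex) \<Rightarrow> (complex \<Rightarrow> complex) \<Rightarrow> bool" where
  "semiflow_generator \<Omega> \<phi> G \<longleftrightarrow>
     (\<forall>z\<in>\<Omega>. ((\<lambda>t. (\<phi> t z - z) / of_real t) \<longlongrightarrow> G z) (at_right 0))"

text \<open>
  A function on \<open>\<Omega>\<close> is represented by its extension by \<open>0\<close> to the plane, so that equality of
  representatives is equality on \<open>\<Omega>\<close>.
\<close>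

definition function_space_on :: "complex set \<Rightarrow> (complex \<Rightarrow> complex) set \<Rightarrow> bool" where
  "function_space_on \<Omega> X \<longleftrightarrow>
     (\<forall>f\<in>X. \<forall>z. z \<notin> \<Omega> \<longrightarrow> f z = 0) \<and>
     ((\<forall>f\<in>X. f holomorphic_on \<Omega>) \<or> (\<forall>f\<in>X. harmonic_on f \<Omega>))"

definition weight ::
    "(real \<Rightarrow> complex \<Rightarrow> complex) \<Rightarrow> (complex \<Rightarrow> complex) \<Rightarrow> real \<Rightarrow> complex \<Rightarrow> complex" where
  "weight \<phi> g t z = exp (integral {0..t} (\<lambda>s. g (\<phi> s z)))"

definition weighted_composition ::
    "complex set \<Rightarrow> (real \<Rightarrow> complex \<Rightarrow> complex) \<Rightarrow> (complex \<Rightarrow> complex) \<Rightarrow>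
     real \<Rightarrow> (complex \<Rightarrow> complex) \<Rightarrow> complex \<Rightarrow> complex" where
  "weighted_composition \<Omega> \<phi> g t f =
     (\<lambda>z. if z \<in> \<Omega> then weight \<phi> g t z * f (\<phi> t z) else 0)"

text \<open>The semigroup law is not part of the definition: it follows from that of \<open>\<phi>\<close>.\<close>

definition admissible ::
    "complex set \<Rightarrow> (real \<Rightarrow> complex \<Rightarrow> complex) \<Rightarrow> (complex \<Rightarrow> complex) \<Rightarrow>
     (complex \<Rightarrow> complex) set \<Rightarrow> ((complex \<Rightarrow> complex) \<Rightarrow> real) \<Rightarrow> bool" where
  "admissible \<Omega> \<phi> g X N \<longleftrightarrow>
     (\<forall>t\<ge>0. weighted_composition \<Omega> \<phi> g t ` X \<subseteq> X) \<and>
     strongly_continuous_on X N (weighted_composition \<Omega> \<phi> g)"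

text \<open>\<open>g \<cdot> f + G \<cdot> f'\<close>, where \<open>G \<cdot> f'\<close> is the derivative in the direction \<open>G\<close>; the lemma shows that
  for holomorphic \<open>f\<close> this is the product of \<open>G\<close> and the complex derivative. That the generator of
  the weighted composition semigroup acts on its domain by this expression uses more than the
  definition of admissibility (it follows, e.g., when the point evaluations are continuous on the
  space), since nothing above relates the norm to pointwise convergence.\<close>

definition robin ::
    "complex set \<Rightarrow> (complex \<Rightarrow> complex) \<Rightarrow> (complex \<Rightarrow> complex) \<Rightarrow>
     (complex \<Rightarrow> complex) \<Rightarrow> complex \<Rightarrow> complex" where
  "robin \<Omega> g G f =
     (\<lambda>z. if z \<in> \<Omega> then g z * f z + frechet_derivative f (at z) (G z) else 0)"

lemma robin_holomorphic:
  assumes "f holomorphic_on \<Omega>" "open \<Omega>" "z \<in> \<Omega>"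
  shows "robin \<Omega> g G f z = g z * f z + G z * deriv f z"
proof -
  have "(f has_derivative (*) (deriv f z)) (at z)"
    using holomorphic_derivI[OF assms] has_field_derivative_def by blast
  then have "frechet_derivative f (at z) = (*) (deriv f z)"
    by (metis frechet_derivative_at)
  then show ?thesis
    using assms(3) by (simp add: robin_def mult.commute)
qed


section \<open>Boundary values and the Dirichlet-to-Robin operator\<close>

text \<open>
  Integration over \<open>\<partial>\<Omega>\<close> is with respect to arc length, that is, one-dimensional Hausdorff measure.
\<close>

definition hausdorff_outer1 :: "complex set \<Rightarrow> ennreal" where
  "hausdorff_outer1 A =
     (SUP \<delta>\<in>{0<..}. INF U\<in>{U :: nat \<Rightarrow> complex set.
          A \<subseteq> (\<Union>i. U i) \<and> (\<forall>i. bounded (U i) \<and> diameter (U i) \<le> (\<delta>::real))}.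
        (\<Sum>i. ennreal (diameter (U i))))"

definition arc_length :: "complex measure" where
  "arc_length = measure_of UNIV (sets borel) hausdorff_outer1"

text \<open>Smooth functions on \<open>\<partial>\<Omega>\<close>: restrictions of smooth functions on the plane, extended by \<open>0\<close>.\<close>

definition boundary_test_functions :: "complex set \<Rightarrow> (complex \<Rightarrow> complex) set" where
  "boundary_test_functions \<Omega> =
     {\<psi>. (\<forall>x. x \<notin> frontier \<Omega> \<longrightarrow> \<psi> x = 0) \<and>
         (\<exists>\<Psi>. smooth_on \<Psi> UNIV \<and> (\<forall>x\<in>frontier \<Omega>. \<psi> x = \<Psi> x))}"

definition conformal_onto_disk :: "complex set \<Rightarrow> (complex \<Rightarrow> complex) \<Rightarrow> bool" where
  "conformal_onto_disk \<Omega> k \<longleftrightarrow> k holomorphic_on \<Omega> \<and> bij_betw k \<Omega> (ball 0 1)"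

text \<open>
  \<open>f\<^sub>r = f \<circ> k\<^sup>-\<^sup>1 \<circ> (r k)\<close>. It is evaluated at boundary points, where \<open>k\<close> stands for its continuous
  (Caratheodory) extension; at points of \<open>\<Omega>\<close> the limit is just the value of \<open>k\<close>.
\<close>

definition dilate ::
    "complex set \<Rightarrow> (complex \<Rightarrow> complex) \<Rightarrow> (complex \<Rightarrow> complex) \<Rightarrow> real \<Rightarrow> complex \<Rightarrow> complex" where
  "dilate \<Omega> k f r x = f (inv_into \<Omega> k (of_real r * Lim (at x within \<Omega>) k))"

definition has_boundary_distribution ::
    "complex set \<Rightarrow> (complex \<Rightarrow> complex) \<Rightarrow> (complex \<Rightarrow> complex) \<Rightarrow> bool" where
  "has_boundary_distribution \<Omega> k f \<longleftrightarrow>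
     (\<forall>\<psi>\<in>boundary_test_functions \<Omega>.
        (\<forall>r\<in>{0<..<1}. set_integrable arc_length (frontier \<Omega>) (\<lambda>x. dilate \<Omega> k f r x * \<psi> x)) \<and>
        (\<exists>L. ((\<lambda>r. LINT x:frontier \<Omega>|arc_length. dilate \<Omega> k f r x * \<psi> x) \<longlongrightarrow> L) (at_left 1)))"

text \<open>
  The boundary distribution \<open>f\<^sup>*\<close>, as a functional on the test functions (\<open>0\<close> elsewhere).
\<close>

definition boundary_trace ::
    "complex set \<Rightarrow> (complex \<Rightarrow> complex) \<Rightarrow> (complex \<Rightarrow> complex) \<Rightarrow>
     (complex \<Rightarrow> complex) \<Rightarrow> complex" where
  "boundary_trace \<Omega> k f =
     (\<lambda>\<psi>. if \<psi> \<in> boundary_test_functions \<Omega>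
          then Lim (at_left 1) (\<lambda>r. LINT x:frontier \<Omega>|arc_length. dilate \<Omega> k f r x * \<psi> x)
          else 0)"

definition boundary_space ::
    "complex set \<Rightarrow> (complex \<Rightarrow> complex) \<Rightarrow> (complex \<Rightarrow> complex) set \<Rightarrow>
     ((complex \<Rightarrow> complex) \<Rightarrow> complex) set" where
  "boundary_space \<Omega> k X = boundary_trace \<Omega> k ` X"

text \<open>
  Linearity of the trace is automatic, and it is isometric for the norm below, so that being an
  isomorphism means being bijective.
\<close>

definition has_boundary_space ::
    "complex set \<Rightarrow> (complex \<Rightarrow> complex) \<Rightarrow> (complex \<Rightarrow> complex) set \<Rightarrow> bool" where
  "has_boundary_space \<Omega> k X \<longleftrightarrow>
     (\<forall>f\<in>X. has_boundary_distribution \<Omega> k f) \<and>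
     bij_betw (boundary_trace \<Omega> k) X (boundary_space \<Omega> k X)"

definition trace_inv ::
    "complex set \<Rightarrow> (complex \<Rightarrow> complex) \<Rightarrow> (complex \<Rightarrow> complex) set \<Rightarrow>
     ((complex \<Rightarrow> complex) \<Rightarrow> complex) \<Rightarrow> complex \<Rightarrow> complex" where
  "trace_inv \<Omega> k X = the_inv_into X (boundary_trace \<Omega> k)"

definition boundary_norm ::
    "complex set \<Rightarrow> (complex \<Rightarrow> complex) \<Rightarrow> (complex \<Rightarrow> complex) set \<Rightarrow>
     ((complex \<Rightarrow> complex) \<Rightarrow> real) \<Rightarrow> ((complex \<Rightarrow> complex) \<Rightarrow> complex) \<Rightarrow> real" where
  "boundary_norm \<Omega> k X N u = N (trace_inv \<Omega> k X u)"

definition dtr_dom ::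
    "complex set \<Rightarrow> (complex \<Rightarrow> complex) \<Rightarrow> (real \<Rightarrow> complex \<Rightarrow> complex) \<Rightarrow> (complex \<Rightarrow> complex) \<Rightarrow>
     (complex \<Rightarrow> complex) set \<Rightarrow> ((complex \<Rightarrow> complex) \<Rightarrow> real) \<Rightarrow>
     ((complex \<Rightarrow> complex) \<Rightarrow> complex) set" where
  "dtr_dom \<Omega> k \<phi> g X N = boundary_trace \<Omega> k ` generator_dom X N (weighted_composition \<Omega> \<phi> g)"

definition dtr ::
    "complex set \<Rightarrow> (complex \<Rightarrow> complex) \<Rightarrow> (complex \<Rightarrow> complex) \<Rightarrow> (complex \<Rightarrow> complex) \<Rightarrow>
     (complex \<Rightarrow> complex) set \<Rightarrow>
     ((complex \<Rightarrow> complex) \<Rightarrow> complex) \<Rightarrow> (complex \<Rightarrow> complex) \<Rightarrow> complex" where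
  "dtr \<Omega> k g G X u = boundary_trace \<Omega> k (robin \<Omega> g G (trace_inv \<Omega> k X u))"

end

theory Submission
  imports Defs
begin

text \<open>
  The trace is a linear bijection of \<open>X\<close> onto the boundary space, and the norm of the boundary space
  makes it an isometry. Everything therefore takes place in \<open>X\<close>: the weighted composition operators
  \<open>S t\<close> form a strongly continuous semigroup on \<open>X\<close> whose generator is \<open>f \<mapsto> g \<cdot> f + G \<cdot> f'\<close>, and
  conjugation by the trace turns this semigroup into one on the boundary space, generated by the
  Dirichlet-to-Robin operator (\<open>generates_transport\<close>). The linearity of the trace is inherited from
  the limits of integrals that define it.

  The semigroup law of \<open>S\<close> amounts to the cocycle identity for the weights (\<open>weight_cocycle\<close>). To
  split the integral in the exponent, \<open>g\<close> has to be integrable along the trajectories. They are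
  continuous because a Jordan domain is bounded, so that its holomorphic self-maps are locally
  Lipschitz with a common constant; this upgrades the right continuity of the semiflow at time \<open>0\<close>
  to continuity at all times (\<open>semiflow_continuous\<close>).

  Well-posedness then holds for every generator on a Banach space (\<open>generates_imp_well_posed\<close>).
  A strongly continuous semigroup is bounded on bounded time intervals by the uniform boundedness
  principle, so orbits starting in the domain of the generator are differentiable from both sides
  and solve the Cauchy problem. For any other solution \<open>u\<close>, the curve \<open>s \<mapsto> T (t - s) (u s)\<close> has
  derivative \<open>0\<close>, whence it agrees with the orbit.
\<close>

section \<open>Limits\<close>

text \<open>
  This turns a limit from the right at \<open>0\<close> into a two-sided limit at \<open>t\<close>: whenever
  \<open>T s\<close> and \<open>T t\<close> belong to a semigroup, the later one factors through the earlier one and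
  \<open>T \<bar>s - t\<bar>\<close>, so that the two sides of \<open>t\<close> can be treated at once.
\<close>

lemma filterlim_abs_diff_at_right: "filterlim (\<lambda>s::real. \<bar>s - t\<bar>) (at_right 0) (at t within S)"
  unfolding filterlim_at
proof
  have "((\<lambda>s. \<bar>s - t\<bar>) \<longlongrightarrow> \<bar>t - t\<bar>) (at t within S)"
    by (intro tendsto_intros)
  then show "((\<lambda>s. \<bar>s - t\<bar>) \<longlongrightarrow> 0) (at t within S)"
    by simp
  show "\<forall>\<^sub>F s in at t within S. \<bar>s - t\<bar> \<in> {0<..} \<and> \<bar>s - t\<bar> \<noteq> 0"
    by (auto simp: eventually_at_filter)
qed

lemma tendsto_0_within_comparison:
  fixes f :: "real \<Rightarrow> real"
  assumes "(g \<longlongrightarrow> 0) (at t within S)"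
    and "\<And>s. s \<in> S \<Longrightarrow> s \<noteq> t \<Longrightarrow> \<bar>f s\<bar> \<le> g s"
  shows "(f \<longlongrightarrow> 0) (at t within S)"
proof (rule Lim_null_comparison[OF _ assms(1)])
  show "\<forall>\<^sub>F s in at t within S. norm (f s) \<le> g s"
    using assms(2) by (simp add: eventually_at_filter)
qed

lemma banach_on_complete:
  assumes "banach_on V N" "\<And>n. F n \<in> V"
    and "\<forall>e>0. \<exists>M. \<forall>m\<ge>M. \<forall>n\<ge>M. N (\<lambda>x. F m x - F n x) < e"
  shows "\<exists>f\<in>V. (\<lambda>n. N (\<lambda>x. F n x - f x)) \<longlonglongrightarrow> 0"
proof -
  have "(\<forall>n. F n \<in> V) \<and> (\<forall>e>0. \<exists>M. \<forall>m\<ge>M. \<forall>n\<ge>M. N (\<lambda>x. F m x - F n x) < e)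
      \<longrightarrow> (\<exists>f\<in>V. (\<lambda>n. N (\<lambda>x. F n x - f x)) \<longlonglongrightarrow> 0)"
    using assms(1) unfolding banach_on_def by (elim conjE) (erule spec)
  then show ?thesis
    by (rule mp) (rule conjI[OF allI[OF assms(2)] assms(3)])
qed

section \<open>Banach function spaces and uniform boundedness\<close>

locale banach_function_space =
  fixes V :: "('b \<Rightarrow> complex) set" and N :: "('b \<Rightarrow> complex) \<Rightarrow> real"
  assumes banach: "banach_on V N"
begin

lemma subspace: "complex_subspace V"
  and norm: "norm_on V N"
  using banach by (auto simp: banach_on_def)

lemma zero_in [simp]: "(\<lambda>_. 0) \<in> V"
  using subspace by (simp add: complex_subspace_def)

lemma add_in [simp]: "f \<in> V \<Longrightarrow> h \<in> V \<Longrightarrow> (\<lambda>x. f x + h x) \<in> V"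
  using subspace by (simp add: complex_subspace_def)

lemma scale_in [simp]: "f \<in> V \<Longrightarrow> (\<lambda>x. c * f x) \<in> V"
  using subspace by (simp add: complex_subspace_def)

lemma diff_in [simp]: "f \<in> V \<Longrightarrow> h \<in> V \<Longrightarrow> (\<lambda>x. f x - h x) \<in> V"
  using add_in[of f "\<lambda>x. -1 * h x"] scale_in[of h "-1"] by simp

lemma divide_in [simp]: "f \<in> V \<Longrightarrow> (\<lambda>x. f x / c) \<in> V"
  using scale_in[of f "inverse c"] by (simp add: field_simps)

lemma N_nonneg [simp]: "f \<in> V \<Longrightarrow> 0 \<le> N f"
  using norm by (simp add: norm_on_def)

lemma N_eq_0_iff: "f \<in> V \<Longrightarrow> N f = 0 \<longleftrightarrow> f = (\<lambda>_. 0)"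
  using norm by (simp add: norm_on_def)

lemma N_zero [simp]: "N (\<lambda>_. 0) = 0"
  using N_eq_0_iff[OF zero_in] by simp

lemma N_triangle: "f \<in> V \<Longrightarrow> h \<in> V \<Longrightarrow> N (\<lambda>x. f x + h x) \<le> N f + N h"
  using norm by (simp add: norm_on_def)

lemma N_scale: "f \<in> V \<Longrightarrow> N (\<lambda>x. c * f x) = cmod c * N f"
  using norm by (simp add: norm_on_def)

lemma N_divide: "f \<in> V \<Longrightarrow> N (\<lambda>x. f x / c) = N f / cmod c"
  using N_scale[of f "inverse c"] by (simp add: field_simps norm_divide)

lemma N_minus_commute:
  assumes "f \<in> V" "h \<in> V" shows "N (\<lambda>x. f x - h x) = N (\<lambda>x. h x - f x)"
  using N_scale[OF diff_in[OF assms], of "-1"] by simp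

lemma N_diff_triangle:
  assumes "f \<in> V" "g \<in> V" "h \<in> V"
  shows "N (\<lambda>x. f x - h x) \<le> N (\<lambda>x. f x - g x) + N (\<lambda>x. g x - h x)"
  using N_triangle[OF diff_in[OF assms(1,2)] diff_in[OF assms(2,3)]] by simp

lemma N_le_add_diff:
  assumes "f \<in> V" "h \<in> V" shows "N f \<le> N h + N (\<lambda>x. f x - h x)"
  using N_triangle[OF assms(2) diff_in[OF assms]] by simp

lemma N_diff_eq_0_iff: "f \<in> V \<Longrightarrow> h \<in> V \<Longrightarrow> N (\<lambda>x. f x - h x) = 0 \<longleftrightarrow> f = h"
  by (auto simp: N_eq_0_iff fun_eq_iff)

lemma N_diff_abs:
  assumes "f \<in> V" "h \<in> V" shows "\<bar>N f - N h\<bar> \<le> N (\<lambda>x. f x - h x)"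
  using N_le_add_diff[OF assms] N_le_add_diff[OF assms(2,1)] N_minus_commute[OF assms] by simp

lemma operator_in: "bounded_operator_on V N A \<Longrightarrow> f \<in> V \<Longrightarrow> A f \<in> V"
  by (simp add: bounded_operator_on_def)

lemma operator_add:
  "bounded_operator_on V N A \<Longrightarrow> f \<in> V \<Longrightarrow> h \<in> V \<Longrightarrow> A (\<lambda>x. f x + h x) = (\<lambda>x. A f x + A h x)"
  by (simp add: bounded_operator_on_def)

lemma operator_scale:
  "bounded_operator_on V N A \<Longrightarrow> f \<in> V \<Longrightarrow> A (\<lambda>x. c * f x) = (\<lambda>x. c * A f x)"
  by (simp add: bounded_operator_on_def)

lemma operator_diff:
  assumes "bounded_operator_on V N A" "f \<in> V" "h \<in> V"
  shows "A (\<lambda>x. f x - h x) = (\<lambda>x. A f x - A h x)"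
  using operator_add[OF assms(1,2) scale_in[OF assms(3), of "-1"]]
    operator_scale[OF assms(1,3), of "-1"] by simp

lemma operator_divide:
  assumes "bounded_operator_on V N A" "f \<in> V"
  shows "A (\<lambda>x. f x / c) = (\<lambda>x. A f x / c)"
  using operator_scale[OF assms, of "inverse c"] by (simp add: field_simps)

text \<open>
  The value \<open>0\<close> off \<open>V\<close> makes the distance nonnegative and symmetric everywhere, as
  \<^locale>\<open>Metric_space\<close> demands, whatever \<open>N\<close> does outside of \<open>V\<close>.
\<close>

definition distance :: "('b \<Rightarrow> complex) \<Rightarrow> ('b \<Rightarrow> complex) \<Rightarrow> real" where
  "distance f h = (if f \<in> V \<and> h \<in> V then N (\<lambda>x. f x - h x) else 0)"

sublocale metric: Metric_space V distance
proof
  show "0 \<le> distance f h" for f h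
    by (simp add: distance_def)
  show "distance f h = distance h f" for f h
    using N_minus_commute by (auto simp: distance_def)
  show "distance f h = 0 \<longleftrightarrow> f = h" if "f \<in> V" "h \<in> V" for f h
    using that by (simp add: distance_def N_diff_eq_0_iff)
  show "distance f h \<le> distance f g + distance g h" if "f \<in> V" "g \<in> V" "h \<in> V" for f g h
    using that by (simp add: distance_def N_diff_triangle)
qed

lemma metric_complete: "metric.mcomplete"
  unfolding metric.mcomplete_def
proof (intro allI impI)
  fix F assume F: "metric.MCauchy F"
  then have FV: "F n \<in> V" for n
    by (auto simp: metric.MCauchy_def)
  have "\<forall>e>0. \<exists>M. \<forall>m\<ge>M. \<forall>n\<ge>M. N (\<lambda>x. F m x - F n x) < e"
    using F by (simp add: metric.MCauchy_def distance_def FV)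
  from banach_on_complete[OF banach FV this]
  obtain f where f: "f \<in> V" "(\<lambda>n. N (\<lambda>x. F n x - f x)) \<longlonglongrightarrow> 0"
    by blast
  have "limitin metric.mtopology F f sequentially"
    unfolding metric.limit_metric_sequentially
    using f FV by (auto simp: distance_def LIMSEQ_iff)
  then show "\<exists>f. limitin metric.mtopology F f sequentially" by blast
qed

text \<open>
  The Banach-Steinhaus theorem for a sequence of operators. The sets \<open>E n\<close> of functions on which all
  operators are bounded by \<open>n\<close> are closed and cover the complete space \<open>V\<close>, so by Baire one of them contains a
  ball around some \<open>f\<close>. Subtracting \<open>f\<close> bounds the operators on a ball around \<open>0\<close>, and homogeneity
  turns this bound into one on all of \<open>V\<close>.
\<close>

lemma uniform_boundedness:
  assumes A: "\<And>i::nat. bounded_operator_on V N (A i)"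
    and pointwise: "\<And>f. f \<in> V \<Longrightarrow> \<exists>B. \<forall>i. N (A i f) \<le> B"
  shows "\<exists>C. \<forall>i. \<forall>f\<in>V. N (A i f) \<le> C * N f"
proof -
  define E where "E n = {f \<in> V. \<forall>i. N (A i f) \<le> real n}" for n :: nat
  have AV: "A i f \<in> V" if "f \<in> V" for i f
    using operator_in[OF A that] .
  have closed: "closedin metric.mtopology (E n)" for n
    unfolding metric.closedin_metric
  proof (intro conjI allI impI)
    show "E n \<subseteq> V"
      by (auto simp: E_def)
    fix f assume f: "f \<in> V - E n"
    then obtain i where i: "N (A i f) > real n"
      by (auto simp: E_def not_le)
    obtain C where C: "\<And>h. h \<in> V \<Longrightarrow> N (A i h) \<le> C * N h"
      using A[of i] unfolding bounded_operator_on_def by blast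
    define r where "r = (N (A i f) - real n) / (\<bar>C\<bar> + 1)"
    have "r > 0"
      using i by (simp add: r_def)
    moreover have "h \<notin> E n" if h: "h \<in> metric.mball f r" for h
    proof -
      have hV: "h \<in> V" and d: "N (\<lambda>x. f x - h x) < r"
        using h by (auto simp: metric.in_mball distance_def split: if_splits)
      have "N (A i f) \<le> N (A i h) + N (\<lambda>x. A i f x - A i h x)"
        using N_le_add_diff AV f hV by blast
      also have "(\<lambda>x. A i f x - A i h x) = A i (\<lambda>x. f x - h x)"
        using operator_diff[OF A] f hV by simp
      also have "N (A i (\<lambda>x. f x - h x)) \<le> C * N (\<lambda>x. f x - h x)"
        using C f hV by simp
      also have "\<dots> \<le> (\<bar>C\<bar> + 1) * N (\<lambda>x. f x - h x)"
        using f hV by (intro mult_right_mono) auto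
      also have "\<dots> < (\<bar>C\<bar> + 1) * r"
        using d by (intro mult_strict_left_mono) auto
      also have "\<dots> = N (A i f) - real n"
        by (simp add: r_def)
      finally have "N (A i h) > real n" by simp
      then show ?thesis
        by (auto simp: E_def not_le)
    qed
    ultimately show "\<exists>r>0. disjnt (E n) (metric.mball f r)"
      unfolding disjnt_iff by blast
  qed
  have cover: "\<Union> (range E) = V"
  proof
    show "V \<subseteq> \<Union> (range E)"
    proof
      fix f assume f: "f \<in> V"
      then obtain B where "\<forall>i. N (A i f) \<le> B" using pointwise by blast
      moreover obtain n where "B \<le> real n" using real_arch_simple by blast
      ultimately have "f \<in> E n" using f order_trans by (auto simp: E_def)
      then show "f \<in> \<Union> (range E)" by blast
    qed
  qed (auto simp: E_def)
  have "\<exists>n. metric.mtopology interior_of (E n) \<noteq> {}"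
  proof (rule ccontr)
    assume "\<nexists>n. metric.mtopology interior_of (E n) \<noteq> {}"
    then have "metric.mtopology interior_of \<Union> (range E) = {}"
      using closed by (intro metric.metric_Baire_category_alt metric_complete) auto
    then show False
      using interior_of_topspace[of metric.mtopology] zero_in
      by (metis cover empty_iff metric.topspace_mtopology)
  qed
  then obtain n f r where f: "f \<in> V" and r: "r > 0" and ball: "metric.mball f r \<subseteq> E n"
    by (auto simp: metric.metric_interior_of)
  have small: "N (A i h) \<le> 2 * real n" if h: "h \<in> V" "N h < r" for i h
  proof -
    have "(\<lambda>x. f x + h x) \<in> metric.mball f r"
      using N_scale[OF h(1), of "-1"] f h by (simp add: metric.in_mball distance_def)
    moreover have "f \<in> metric.mball f r"
      using f r by simp
    ultimately have *: "N (A i (\<lambda>x. f x + h x)) \<le> real n" "N (A i f) \<le> real n"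
      using ball by (auto simp: E_def)
    have "N (A i h) \<le> N (A i (\<lambda>x. f x + h x)) + N (\<lambda>x. A i h x - A i (\<lambda>x. f x + h x) x)"
      using f h by (intro N_le_add_diff AV) auto
    also have "(\<lambda>x. A i h x - A i (\<lambda>x. f x + h x) x) = (\<lambda>x. -1 * A i f x)"
      using operator_add[OF A] f h by simp
    also have "N \<dots> = N (A i f)"
      using N_scale[OF AV[OF f], of "-1"] by simp
    finally show ?thesis using * by simp
  qed
  have "N (A i h) \<le> (4 * real n / r) * N h" if h: "h \<in> V" for i h
  proof (cases "N h = 0")
    case True
    obtain C where "N (A i h) \<le> C * N h"
      using A[of i] h unfolding bounded_operator_on_def by blast
    then show ?thesis using True by simp
  next
    case False
    then have pos: "N h > 0" using N_nonneg[OF h] by simp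
    define c where "c = r / (2 * N h)"
    have c: "c > 0" using r pos by (simp add: c_def)
    have "N (\<lambda>x. of_real c * h x) = c * N h"
      using N_scale[OF h, of "of_real c"] c by simp
    also have "\<dots> < r"
      using r pos by (simp add: c_def)
    finally have "N (\<lambda>x. of_real c * h x) < r" .
    then have "N (A i (\<lambda>x. of_real c * h x)) \<le> 2 * real n"
      using small h by simp
    then have "c * N (A i h) \<le> 2 * real n"
      using operator_scale[OF A h] N_scale[OF AV[OF h]] c by simp
    then show ?thesis using r pos by (simp add: c_def field_simps)
  qed
  then show ?thesis by blast
qed

end


section \<open>Strongly continuous semigroups and the abstract Cauchy problem\<close>

locale function_semigroup = banach_function_space V N
  for V :: "('b \<Rightarrow> complex) set" and N +
  fixes T :: "real \<Rightarrow> ('b \<Rightarrow> complex) \<Rightarrow> 'b \<Rightarrow> complex"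
  assumes semigroup: "C0_semigroup V N T"
begin

lemma T_bounded: "0 \<le> t \<Longrightarrow> bounded_operator_on V N (T t)"
  and T_0 [simp]: "f \<in> V \<Longrightarrow> T 0 f = f"
  and T_add: "0 \<le> s \<Longrightarrow> 0 \<le> t \<Longrightarrow> f \<in> V \<Longrightarrow> T (s + t) f = T s (T t f)"
  and T_tendsto: "f \<in> V \<Longrightarrow> ((\<lambda>t. N (\<lambda>x. T t f x - f x)) \<longlongrightarrow> 0) (at_right 0)"
  using semigroup by (auto simp: C0_semigroup_def strongly_continuous_on_def)

lemma T_in [simp]: "0 \<le> t \<Longrightarrow> f \<in> V \<Longrightarrow> T t f \<in> V"
  using operator_in[OF T_bounded] .

lemma T_diff:
  "0 \<le> t \<Longrightarrow> f \<in> V \<Longrightarrow> h \<in> V \<Longrightarrow> T t (\<lambda>x. f x - h x) = (\<lambda>x. T t f x - T t h x)"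
  using operator_diff[OF T_bounded] .

lemma T_divide: "0 \<le> t \<Longrightarrow> f \<in> V \<Longrightarrow> T t (\<lambda>x. f x / c) = (\<lambda>x. T t f x / c)"
  using operator_divide[OF T_bounded] .

text \<open>
  If the operators were unbounded arbitrarily close to time \<open>0\<close>, there would be times \<open>t n\<close> tending
  to \<open>0\<close> with norms exceeding every \<open>n\<close>. But \<open>T (t n) h\<close> converges to \<open>h\<close> for each \<open>h\<close>, so these
  operators are pointwise bounded, against the uniform boundedness principle.
\<close>

lemma bounded_near_0:
  obtains M \<delta> where "0 < \<delta>" "\<And>t f. 0 < t \<Longrightarrow> t \<le> \<delta> \<Longrightarrow> f \<in> V \<Longrightarrow> N (T t f) \<le> M * N f"
proof (rule ccontr)
  assume neg: "\<not> thesis"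
  have "\<exists>t f. 0 < t \<and> t \<le> 1 / real (Suc n) \<and> f \<in> V \<and> real n * N f < N (T t f)" for n
  proof (rule ccontr)
    assume small: "\<not> ?thesis"
    have thesis
    proof (rule that)
      show "0 < 1 / real (Suc n)" by simp
      show "N (T t f) \<le> real n * N f" if "0 < t" "t \<le> 1 / real (Suc n)" "f \<in> V" for t f
        using small that by (meson not_le)
    qed
    with neg show False ..
  qed
  then obtain t f where t: "\<And>n. 0 < t n" "\<And>n. t n \<le> 1 / real (Suc n)"
    and f: "\<And>n. f n \<in> V" "\<And>n. real n * N (f n) < N (T (t n) (f n))"
    by metis
  have "t \<longlonglongrightarrow> 0"
    by (rule tendsto_sandwich[OF _ _ tendsto_const LIMSEQ_Suc[OF lim_1_over_n]])
      (use t in \<open>auto intro!: always_eventually less_imp_le simp del: of_nat_Suc\<close>)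
  then have t0: "filterlim t (at_right 0) sequentially"
    unfolding filterlim_at using t(1) by (metis (mono_tags, lifting) always_eventually greaterThan_iff order_less_irrefl)
  have "\<exists>B. \<forall>n. N (T (t n) h) \<le> B" if h: "h \<in> V" for h
  proof -
    have "Bseq (\<lambda>n. N (\<lambda>x. T (t n) h x - h x))"
      using filterlim_compose[OF T_tendsto[OF h] t0] by (intro convergent_imp_Bseq convergentI)
    then obtain K where K: "\<And>n. norm (N (\<lambda>x. T (t n) h x - h x)) \<le> K"
      by (auto simp: Bseq_def)
    have "N (T (t n) h) \<le> N h + K" for n
      using N_le_add_diff[of "T (t n) h" h] K[of n] t(1)[of n] h by fastforce
    then show ?thesis by blast
  qed
  then obtain C where C: "\<And>n h. h \<in> V \<Longrightarrow> N (T (t n) h) \<le> C * N h"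
    using uniform_boundedness[of "\<lambda>n. T (t n)"] T_bounded t(1) less_imp_le by metis
  obtain n where "C \<le> real n" using real_arch_simple by blast
  then have "C * N (f n) \<le> real n * N (f n)"
    using f by (intro mult_right_mono) auto
  then show False using C[OF f(1), of n n] f(2)[of n] by simp
qed

text \<open>
  A bound \<open>L \<ge> 1\<close> on \<open>[0, \<delta>]\<close> gives the bound \<open>L ^ n\<close> on \<open>[0, n * \<delta>]\<close> by the semigroup law.
\<close>

lemma bounded_on_intervals:
  "\<exists>M\<ge>0. \<forall>t f. 0 \<le> t \<longrightarrow> t \<le> \<tau> \<longrightarrow> f \<in> V \<longrightarrow> N (T t f) \<le> M * N f"
proof -
  obtain K \<delta> where \<delta>: "0 < \<delta>"
    and K: "\<And>t f. 0 < t \<Longrightarrow> t \<le> \<delta> \<Longrightarrow> f \<in> V \<Longrightarrow> N (T t f) \<le> K * N f"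
    using bounded_near_0 by metis
  define L where "L = max 1 K"
  have L: "N (T t f) \<le> L * N f" if "0 \<le> t" "t \<le> \<delta>" "f \<in> V" for t f
  proof (cases "t = 0")
    case True
    then show ?thesis
      using that mult_right_mono[of 1 L "N f"] by (simp add: L_def)
  next
    case False
    then have "N (T t f) \<le> K * N f" using K that by simp
    also have "\<dots> \<le> L * N f" using that by (intro mult_right_mono) (auto simp: L_def)
    finally show ?thesis .
  qed
  have pow: "N (T t f) \<le> L ^ Suc n * N f" if "0 \<le> t" "t \<le> real (Suc n) * \<delta>" "f \<in> V" for n t f
    using that
  proof (induction n arbitrary: t f)
    case 0
    then show ?case using L by simp
  next
    case (Suc n)
    \<comment> \<open>\<open>max 0\<close> covers the times \<open>t < \<delta>\<close>, for which no step of length \<open>\<delta>\<close> is possible.\<close>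
    define s where "s = max 0 (t - \<delta>)"
    have s: "0 \<le> s" "0 \<le> t - s" "t - s \<le> \<delta>" "s \<le> real (Suc n) * \<delta>"
      using Suc.prems \<delta> by (auto simp: s_def algebra_simps)
    have "N (T t f) = N (T (t - s) (T s f))"
      using T_add[of "t - s" s f] s Suc.prems by simp
    also have "\<dots> \<le> L * N (T s f)"
      using L s Suc.prems by simp
    also have "\<dots> \<le> L * (L ^ Suc n * N f)"
      using Suc.IH[OF s(1,4) Suc.prems(3)] by (intro mult_left_mono) (auto simp: L_def)
    finally show ?case by (simp add: mult.assoc)
  qed
  obtain n where "\<tau> / \<delta> \<le> real n" using real_arch_simple by blast
  then have "\<tau> \<le> real (Suc n) * \<delta>"
    using \<delta> by (simp add: field_simps)
  then have "N (T t f) \<le> L ^ Suc n * N f" if "0 \<le> t" "t \<le> \<tau>" "f \<in> V" for t f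
    using pow[of t n f] that by linarith
  moreover have "0 \<le> L ^ Suc n"
    by (simp add: L_def)
  ultimately show ?thesis by blast
qed

text \<open>
  With \<open>m\<close> the smaller of the times \<open>s\<close> and \<open>t\<close>, the difference of \<open>T s f\<close> and \<open>T t f\<close> is, up to
  sign, the image of \<open>T \<bar>s - t\<bar> f - f\<close> under \<open>T m\<close>. The bound on \<open>[0, t]\<close> is what makes the
  approach from the left work, where \<open>m = s\<close> varies.
\<close>

lemma orbit_continuous:
  assumes t: "0 \<le> t" and f: "f \<in> V"
  shows "((\<lambda>s. N (\<lambda>x. T s f x - T t f x)) \<longlongrightarrow> 0) (at t within {0..})"
proof -
  obtain M where M: "0 \<le> M" "\<And>s f. 0 \<le> s \<Longrightarrow> s \<le> t \<Longrightarrow> f \<in> V \<Longrightarrow> N (T s f) \<le> M * N f"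
    using bounded_on_intervals[of t] by blast
  have le: "N (\<lambda>x. T s f x - T t f x) \<le> M * N (\<lambda>x. T \<bar>s - t\<bar> f x - f x)" if s: "0 \<le> s" for s
  proof -
    have "N (\<lambda>x. T s f x - T t f x) = N (T (min s t) (\<lambda>x. T \<bar>s - t\<bar> f x - f x))"
    proof (cases "s \<le> t")
      case True
      then have "T t f = T s (T (t - s) f)"
        using T_add[of s "t - s" f] s f by simp
      then show ?thesis
        using True s t f T_diff[of s "T (t - s) f" f] N_minus_commute[of "T s f" "T t f"] by simp
    next
      case False
      then have "T s f = T t (T (s - t) f)"
        using T_add[of t "s - t" f] t f by simp
      then show ?thesis
        using False s t f T_diff[of t "T (s - t) f" f] by simp
    qed
    then show ?thesis
      using M(2)[of "min s t"] s t f by simp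
  qed
  have "((\<lambda>s. M * N (\<lambda>x. T \<bar>s - t\<bar> f x - f x)) \<longlongrightarrow> M * 0) (at t within {0..})"
    by (intro tendsto_mult tendsto_const filterlim_compose[OF T_tendsto[OF f] filterlim_abs_diff_at_right])
  then have lim: "((\<lambda>s. M * N (\<lambda>x. T \<bar>s - t\<bar> f x - f x)) \<longlongrightarrow> 0) (at t within {0..})"
    by simp
  show ?thesis
    by (rule tendsto_0_within_comparison[OF lim]) (use le t f in simp)
qed

lemma generator_graph_orbit:
  assumes t: "0 \<le> t" and graph: "generator_graph V N T f h"
  shows "generator_graph V N T (T t f) (T t h)"
proof -
  have f: "f \<in> V" and h: "h \<in> V"
    and lim: "((\<lambda>s. N (\<lambda>x. (T s f x - f x) / of_real s - h x)) \<longlongrightarrow> 0) (at_right 0)"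
    using graph by (auto simp: generator_graph_def)
  obtain C where C: "\<And>f. f \<in> V \<Longrightarrow> N (T t f) \<le> C * N f"
    using T_bounded[OF t] unfolding bounded_operator_on_def by blast
  have le: "\<bar>N (\<lambda>x. (T s (T t f) x - T t f x) / of_real s - T t h x)\<bar>
      \<le> C * N (\<lambda>x. (T s f x - f x) / of_real s - h x)" if s: "0 < s" for s
  proof -
    have "T s (T t f) = T t (T s f)"
      using T_add[of s t f] T_add[of t s f] s t f by (simp add: add.commute)
    then have "(\<lambda>x. (T s (T t f) x - T t f x) / of_real s - T t h x)
        = T t (\<lambda>x. (T s f x - f x) / of_real s - h x)"
      using s t f h by (simp add: T_diff T_divide)
    then show ?thesis
      using C[of "\<lambda>x. (T s f x - f x) / of_real s - h x"] s t f h by simp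
  qed
  have "((\<lambda>s. C * N (\<lambda>x. (T s f x - f x) / of_real s - h x)) \<longlongrightarrow> C * 0) (at_right 0)"
    by (intro tendsto_mult tendsto_const lim)
  then have lim': "((\<lambda>s. C * N (\<lambda>x. (T s f x - f x) / of_real s - h x)) \<longlongrightarrow> 0) (at_right 0)"
    by simp
  have "((\<lambda>s. N (\<lambda>x. (T s (T t f) x - T t f x) / of_real s - T t h x)) \<longlongrightarrow> 0) (at_right 0)"
    by (rule tendsto_0_within_comparison[OF lim']) (rule le, simp)
  then show ?thesis
    using t f h by (simp add: generator_graph_def)
qed

text \<open>
  With \<open>q r\<close> the error of the difference quotient of step \<open>r\<close> at \<open>0\<close> and \<open>m\<close> the smaller time, the
  error at \<open>t\<close> is \<open>T m (q \<bar>s - t\<bar>) + (T m h - T t h)\<close>. The first term vanishes in the limit since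
  the operators are bounded on \<open>[0, t]\<close>, the second one by continuity of the orbit of \<open>h\<close>.
\<close>

lemma orbit_derivative:
  assumes t: "0 \<le> t" and graph: "generator_graph V N T f h"
  shows "((\<lambda>s. N (\<lambda>x. (T s f x - T t f x) / of_real (s - t) - T t h x)) \<longlongrightarrow> 0) (at t within {0..})"
proof -
  have f: "f \<in> V" and h: "h \<in> V"
    and lim: "((\<lambda>s. N (\<lambda>x. (T s f x - f x) / of_real s - h x)) \<longlongrightarrow> 0) (at_right 0)"
    using graph by (auto simp: generator_graph_def)
  obtain M where M: "0 \<le> M" "\<And>s f. 0 \<le> s \<Longrightarrow> s \<le> t \<Longrightarrow> f \<in> V \<Longrightarrow> N (T s f) \<le> M * N f"
    using bounded_on_intervals[of t] by blast
  define q where "q r = (\<lambda>x. (T r f x - f x) / of_real r - h x)" for r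
  have q: "q r \<in> V" if "0 \<le> r" for r
    using that f h by (simp add: q_def)
  have le: "N (\<lambda>x. (T s f x - T t f x) / of_real (s - t) - T t h x)
      \<le> M * N (q \<bar>s - t\<bar>) + N (\<lambda>x. T (min s t) h x - T t h x)" if s: "0 \<le> s" "s \<noteq> t" for s
  proof -
    have "(\<lambda>x. (T s f x - T t f x) / of_real (s - t) - T t h x)
        = (\<lambda>x. T (min s t) (q \<bar>s - t\<bar>) x + (T (min s t) h x - T t h x))"
    proof (cases "s < t")
      case True
      then have "T t f = T s (T (t - s) f)"
        using T_add[of s "t - s" f] s f by simp
      moreover have "T s (q (t - s)) = (\<lambda>x. (T s (T (t - s) f) x - T s f x) / of_real (t - s) - T s h x)"
        using True s t f h unfolding q_def by (simp add: T_diff T_divide del: of_real_diff)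
      moreover have "(a - b) / of_real (s - t) = (b - a) / of_real (t - s)" for a b :: complex
        using minus_divide_divide[of "b - a" "of_real (t - s)"] by simp
      ultimately show ?thesis
        using True by (simp add: min_def del: of_real_diff)
    next
      case False
      then have "T s f = T t (T (s - t) f)"
        using T_add[of t "s - t" f] t f by simp
      then show ?thesis
        using False s t f h unfolding q_def by (simp add: T_diff T_divide)
    qed
    then have "N (\<lambda>x. (T s f x - T t f x) / of_real (s - t) - T t h x)
        \<le> N (T (min s t) (q \<bar>s - t\<bar>)) + N (\<lambda>x. T (min s t) h x - T t h x)"
      using N_triangle[of "T (min s t) (q \<bar>s - t\<bar>)" "\<lambda>x. T (min s t) h x - T t h x"] q s t h
      by simp
    then show ?thesis
      using M(2)[of "min s t" "q \<bar>s - t\<bar>"] q s t by simp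
  qed
  have le': "N (\<lambda>x. T (min s t) h x - T t h x) \<le> N (\<lambda>x. T s h x - T t h x)" if "0 \<le> s" for s
    using that t h by (cases "s \<le> t") (auto simp: min_def)
  have "((\<lambda>s. M * N (q \<bar>s - t\<bar>) + N (\<lambda>x. T s h x - T t h x)) \<longlongrightarrow> M * 0 + 0) (at t within {0..})"
    using lim unfolding q_def
    by (intro tendsto_add tendsto_mult tendsto_const orbit_continuous t h
        filterlim_compose[OF lim filterlim_abs_diff_at_right])
  then have lim': "((\<lambda>s. M * N (q \<bar>s - t\<bar>) + N (\<lambda>x. T s h x - T t h x)) \<longlongrightarrow> 0) (at t within {0..})"
    by simp
  have "\<bar>N (\<lambda>x. (T s f x - T t f x) / of_real (s - t) - T t h x)\<bar>
      \<le> M * N (q \<bar>s - t\<bar>) + N (\<lambda>x. T s h x - T t h x)" if s: "0 \<le> s" "s \<noteq> t" for s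
    using le[OF s] le'[OF s(1)] s t f h by simp
  then show ?thesis
    by (intro tendsto_0_within_comparison[OF lim']) auto
qed

text \<open>
  The mean value theorem for curves in \<open>V\<close> reduces to the scalar one: the distance to the initial
  point has derivative \<open>0\<close> by the reverse triangle inequality, so it remains \<open>0\<close>.
\<close>

lemma zero_derivative_imp_constant:
  assumes w: "\<And>s. 0 \<le> s \<Longrightarrow> s \<le> t \<Longrightarrow> w s \<in> V"
    and deriv: "\<And>s. 0 \<le> s \<Longrightarrow> s \<le> t \<Longrightarrow>
      ((\<lambda>r. N (\<lambda>x. (w r x - w s x) / of_real (r - s))) \<longlongrightarrow> 0) (at s within {0..t})"
    and t: "0 \<le> t"
  shows "w t = w 0"
proof -
  define \<psi> where "\<psi> s = N (\<lambda>x. w s x - w 0 x)" for s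
  have "(\<psi> has_real_derivative 0) (at s within {0..t})" if s: "s \<in> {0..t}" for s
  proof -
    have "\<bar>(\<psi> r - \<psi> s) / (r - s)\<bar> \<le> N (\<lambda>x. (w r x - w s x) / of_real (r - s))"
      if r: "r \<in> {0..t}" for r
    proof -
      have "\<bar>\<psi> r - \<psi> s\<bar> \<le> N (\<lambda>x. (w r x - w 0 x) - (w s x - w 0 x))"
        unfolding \<psi>_def using r s w t by (intro N_diff_abs) auto
      then have "\<bar>\<psi> r - \<psi> s\<bar> / \<bar>r - s\<bar> \<le> N (\<lambda>x. w r x - w s x) / \<bar>r - s\<bar>"
        by (intro divide_right_mono) auto
      also have "\<dots> = N (\<lambda>x. (w r x - w s x) / of_real (r - s))"
        using N_divide[of "\<lambda>x. w r x - w s x" "of_real (r - s)"] r s w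
        by (simp del: of_real_diff)
      finally show ?thesis by simp
    qed
    then have "((\<lambda>r. (\<psi> r - \<psi> s) / (r - s)) \<longlongrightarrow> 0) (at s within {0..t})"
      using s by (intro tendsto_0_within_comparison[OF deriv]) auto
    then show ?thesis
      by (simp add: has_field_derivative_iff)
  qed
  then have "\<exists>c. \<forall>s\<in>{0..t}. \<psi> s = c"
    by (intro has_field_derivative_zero_constant) auto
  then have "\<psi> t = \<psi> 0"
    using t by auto
  then have "N (\<lambda>x. w t x - w 0 x) = 0"
    by (simp add: \<psi>_def)
  then show ?thesis
    using w t by (simp add: N_diff_eq_0_iff)
qed

text \<open>
  The classical argument: for a solution \<open>u\<close>, the curve \<open>w s = T (t - s) (u s)\<close> has derivative
  \<open>T (t - s) (A (u s)) - T (t - s) (A (u s)) = 0\<close>, so that \<open>u t = w t = w 0 = T t u\<^sub>0\<close>. The product rule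
  behind this is spelled out by means of the error \<open>p\<close> of the difference quotient of \<open>u\<close> at \<open>s\<close> and
  the error \<open>q\<close> of that of the orbit of \<open>u s\<close> at \<open>t - s\<close>.
\<close>

lemma classical_solution_unique:
  assumes D: "\<And>f. f \<in> D \<Longrightarrow> generator_graph V N T f (A f)"
    and u: "classical_solution N D A u\<^sub>0 u" and t: "0 \<le> t"
  shows "u t = T t u\<^sub>0"
proof -
  have uD: "u s \<in> D" if "0 \<le> s" for s
    using u that by (simp add: classical_solution_def)
  have uV: "u s \<in> V" and AV: "A (u s) \<in> V" if "0 \<le> s" for s
    using D[OF uD[OF that]] by (auto simp: generator_graph_def)
  obtain M where M: "0 \<le> M" "\<And>s f. 0 \<le> s \<Longrightarrow> s \<le> t \<Longrightarrow> f \<in> V \<Longrightarrow> N (T s f) \<le> M * N f"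
    using bounded_on_intervals[of t] by blast
  define w where "w s = T (t - s) (u s)" for s
  have "((\<lambda>r. N (\<lambda>x. (w r x - w s x) / of_real (r - s))) \<longlongrightarrow> 0) (at s within {0..t})"
    if s: "0 \<le> s" "s \<le> t" for s
  proof -
    define a where "a = A (u s)"
    have a: "a \<in> V" using AV s by (simp add: a_def)
    define p where "p r = (\<lambda>x. (u r x - u s x) / of_real (r - s) - a x)" for r
    define q where "q r = (\<lambda>x. (T r (u s) x - T (t - s) (u s) x) / of_real (r - (t - s)) - T (t - s) a x)" for r
    have le: "\<bar>N (\<lambda>x. (w r x - w s x) / of_real (r - s))\<bar>
        \<le> M * N (p r) + (N (\<lambda>x. T (t - r) a x - T (t - s) a x) + N (q (t - r)))"
      if r: "r \<in> {0..t}" "r \<noteq> s" for r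
    proof -
      have pq: "p r \<in> V" "q (t - r) \<in> V"
        using r s uV a by (auto simp: p_def q_def)
      have "(\<lambda>x. (w r x - w s x) / of_real (r - s))
        = (\<lambda>x. T (t - r) (p r) x + ((T (t - r) a x - T (t - s) a x) - q (t - r) x))"
      proof -
        have "T (t - r) (p r) = (\<lambda>x. (T (t - r) (u r) x - T (t - r) (u s) x) / of_real (r - s) - T (t - r) a x)"
          using r s uV a unfolding p_def by (simp add: T_diff T_divide del: of_real_diff)
        moreover have "b / of_real (s - r) = - (b / of_real (r - s))" for b :: complex
          using minus_divide_right[of b "of_real (r - s)"] by simp
        ultimately show ?thesis
          unfolding q_def w_def by (simp add: diff_divide_distrib del: of_real_diff)
      qed
      then have "N (\<lambda>x. (w r x - w s x) / of_real (r - s))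
        \<le> N (T (t - r) (p r)) + N (\<lambda>x. (T (t - r) a x - T (t - s) a x) - q (t - r) x)"
        using N_triangle[of "T (t - r) (p r)" "\<lambda>x. (T (t - r) a x - T (t - s) a x) - q (t - r) x"]
          r s a pq by simp
      also have "N (T (t - r) (p r)) \<le> M * N (p r)"
        using M(2)[of "t - r" "p r"] r pq by simp
      also have "N (\<lambda>x. (T (t - r) a x - T (t - s) a x) - q (t - r) x)
          \<le> N (\<lambda>x. T (t - r) a x - T (t - s) a x) + N (q (t - r))"
        using N_diff_triangle[of "\<lambda>x. T (t - r) a x - T (t - s) a x" "\<lambda>_. 0" "q (t - r)"]
          N_scale[of "q (t - r)" "-1"] r s a pq by simp
      finally show ?thesis
        using r s uV by (simp add: w_def)
    qed
    \<comment> \<open>The reflection \<open>r \<mapsto> t - r\<close> carries the limits along the orbits to limits at \<open>s\<close>.\<close>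
    have reflection: "filterlim (\<lambda>r. t - r) (at (t - s) within {0..}) (at s within {0..t})"
      unfolding filterlim_at
    proof
      show "((\<lambda>r. t - r) \<longlongrightarrow> t - s) (at s within {0..t})"
        by (intro tendsto_intros)
    qed (auto simp: eventually_at_filter)
    have "((\<lambda>r. N (p r)) \<longlongrightarrow> 0) (at s within {0..})"
      using u s unfolding classical_solution_def p_def a_def by blast
    then have "((\<lambda>r. N (p r)) \<longlongrightarrow> 0) (at s within {0..t})"
      by (rule tendsto_within_subset) auto
    moreover have "((\<lambda>r. N (\<lambda>x. T (t - r) a x - T (t - s) a x)) \<longlongrightarrow> 0) (at s within {0..t})"
      using s a by (intro filterlim_compose[OF orbit_continuous reflection]) auto
    moreover have "((\<lambda>r. N (q r)) \<longlongrightarrow> 0) (at (t - s) within {0..})"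
      using orbit_derivative[OF _ D[OF uD[OF s(1)]], of "t - s"] s unfolding q_def a_def by simp
    then have "((\<lambda>r. N (q (t - r))) \<longlongrightarrow> 0) (at s within {0..t})"
      by (rule filterlim_compose[OF _ reflection])
    ultimately have "((\<lambda>r. M * N (p r) + (N (\<lambda>x. T (t - r) a x - T (t - s) a x) + N (q (t - r))))
        \<longlongrightarrow> M * 0 + (0 + 0)) (at s within {0..t})"
      by (intro tendsto_add tendsto_mult tendsto_const)
    then have lim: "((\<lambda>r. M * N (p r) + (N (\<lambda>x. T (t - r) a x - T (t - s) a x) + N (q (t - r))))
        \<longlongrightarrow> 0) (at s within {0..t})"
      by simp
    show ?thesis
      by (rule tendsto_0_within_comparison[OF lim le])
  qed
  then have "w t = w 0"
    using t uV by (intro zero_derivative_imp_constant) (auto simp: w_def)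
  moreover have "u 0 = u\<^sub>0"
    using u by (simp add: classical_solution_def)
  ultimately show ?thesis
    using t uV by (simp add: w_def)
qed

end

lemma generates_imp_well_posed:
  assumes "banach_on V N" and gen: "generates V N D A T"
  shows "well_posed_with V N D A T"
proof -
  interpret function_semigroup V N T
    using assms by unfold_locales (simp_all add: generates_def)
  have graph: "generator_graph V N T f h \<longleftrightarrow> f \<in> D \<and> h = A f" for f h
    using gen by (simp add: generates_def)
  have "classical_solution N D A u\<^sub>0 u \<longleftrightarrow> (\<forall>t\<ge>0. u t = T t u\<^sub>0)" if u\<^sub>0: "u\<^sub>0 \<in> D" for u\<^sub>0 u
  proof
    assume "classical_solution N D A u\<^sub>0 u"
    then show "\<forall>t\<ge>0. u t = T t u\<^sub>0"
      using classical_solution_unique[of D A] graph by blast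
  next
    assume eq: "\<forall>t\<ge>0. u t = T t u\<^sub>0"
    have g: "generator_graph V N T u\<^sub>0 (A u\<^sub>0)"
      using u\<^sub>0 graph by blast
    then have V: "u\<^sub>0 \<in> V" by (simp add: generator_graph_def)
    have "u t \<in> D \<and> ((\<lambda>s. N (\<lambda>x. (u s x - u t x) / of_real (s - t) - A (u t) x)) \<longlongrightarrow> 0)
      (at t within {0..})" if t: "0 \<le> t" for t
    proof
      have *: "T t u\<^sub>0 \<in> D" "T t (A u\<^sub>0) = A (T t u\<^sub>0)"
        using generator_graph_orbit[OF t g] graph by auto
      then show "u t \<in> D" using eq t by simp
      have "((\<lambda>s. N (\<lambda>x. (T s u\<^sub>0 x - T t u\<^sub>0 x) / of_real (s - t) - A (T t u\<^sub>0) x)) \<longlongrightarrow> 0)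
        (at t within {0..})"
        using orbit_derivative[OF t g] * by simp
      moreover have "\<forall>\<^sub>F s in at t within {0..}.
          N (\<lambda>x. (T s u\<^sub>0 x - T t u\<^sub>0 x) / of_real (s - t) - A (T t u\<^sub>0) x)
          = N (\<lambda>x. (u s x - u t x) / of_real (s - t) - A (u t) x)"
        using eq t by (auto simp: eventually_at_filter)
      ultimately show "((\<lambda>s. N (\<lambda>x. (u s x - u t x) / of_real (s - t) - A (u t) x)) \<longlongrightarrow> 0)
        (at t within {0..})"
        by (rule Lim_transform_eventually)
    qed
    then show "classical_solution N D A u\<^sub>0 u"
      using eq V by (simp add: classical_solution_def)
  qed
  then show ?thesis
    using assms by (simp add: well_posed_with_def)
qed

lemma generates_generator_dom:
  assumes "C0_semigroup V N T" "\<And>f h. generator_graph V N T f h \<Longrightarrow> h = A f"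
  shows "generates V N (generator_dom V N T) A T"
  using assms by (auto simp: generates_def generator_dom_def)

section \<open>Transport along a linear bijection\<close>

text \<open>
  \<open>V\<close> is to be the space of functions in the domain, \<open>W\<close> the space of their boundary values, \<open>J\<close>
  the trace and \<open>I\<close> its inverse. The norm \<open>N \<circ> I\<close> on \<open>W\<close> makes \<open>J\<close> an isometry, and similarity by
  \<open>J\<close> carries every statement on \<open>V\<close> about norms, semigroups and generators over to \<open>W\<close>.
\<close>

locale linear_bijection =
  fixes V :: "('b \<Rightarrow> complex) set" and W :: "('c \<Rightarrow> complex) set"
    and J :: "('b \<Rightarrow> complex) \<Rightarrow> 'c \<Rightarrow> complex" and I :: "('c \<Rightarrow> complex) \<Rightarrow> 'b \<Rightarrow> complex"
  assumes V: "complex_subspace V"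
    and W: "W = J ` V"
    and I_J [simp]: "f \<in> V \<Longrightarrow> I (J f) = f"
    and J_add: "f \<in> V \<Longrightarrow> h \<in> V \<Longrightarrow> J (\<lambda>x. f x + h x) = (\<lambda>y. J f y + J h y)"
    and J_scale: "f \<in> V \<Longrightarrow> J (\<lambda>x. c * f x) = (\<lambda>y. c * J f y)"
begin

lemma V_zero: "(\<lambda>_. 0) \<in> V"
  and V_add: "f \<in> V \<Longrightarrow> h \<in> V \<Longrightarrow> (\<lambda>x. f x + h x) \<in> V"
  and V_scale: "f \<in> V \<Longrightarrow> (\<lambda>x. c * f x) \<in> V"
  using V by (auto simp: complex_subspace_def)

lemma J_in: "f \<in> V \<Longrightarrow> J f \<in> W"
  and I_in: "u \<in> W \<Longrightarrow> I u \<in> V"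
  and J_I: "u \<in> W \<Longrightarrow> J (I u) = u"
  by (auto simp: W)

lemma J_zero: "J (\<lambda>_. 0) = (\<lambda>_. 0)"
  using J_scale[OF V_zero, of 0] by simp

lemma W_subspace: "complex_subspace W"
  unfolding complex_subspace_def
proof (intro conjI allI ballI)
  show "(\<lambda>_. 0) \<in> W"
    using J_in[OF V_zero] by (simp add: J_zero)
  show "(\<lambda>y. u y + v y) \<in> W" if "u \<in> W" "v \<in> W" for u v
    using J_in[OF V_add[OF that[THEN I_in]]] J_add[OF that[THEN I_in]] that by (simp add: J_I)
  show "(\<lambda>y. c * u y) \<in> W" if "u \<in> W" for c u
    using J_in[OF V_scale[OF I_in[OF that]]] J_scale[OF I_in[OF that]] that by (simp add: J_I)
qed

lemma I_add: "u \<in> W \<Longrightarrow> v \<in> W \<Longrightarrow> I (\<lambda>y. u y + v y) = (\<lambda>x. I u x + I v x)"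
  using J_add[OF I_in I_in, of u v] I_J[OF V_add[OF I_in I_in], of u v] by (simp add: J_I)

lemma I_scale: "u \<in> W \<Longrightarrow> I (\<lambda>y. c * u y) = (\<lambda>x. c * I u x)"
  using J_scale[OF I_in, of u] I_J[OF V_scale[OF I_in], of u] by (simp add: J_I)

lemma inverse: "linear_bijection W V I J"
proof
  show "V = I ` W"
    by (auto simp: W image_image)
qed (auto simp: W_subspace J_I I_add I_scale)

lemma V_diff: "f \<in> V \<Longrightarrow> h \<in> V \<Longrightarrow> (\<lambda>x. f x - h x) \<in> V"
  using V_add[OF _ V_scale, of f h "-1"] by simp

lemma J_diff: "f \<in> V \<Longrightarrow> h \<in> V \<Longrightarrow> J (\<lambda>x. f x - h x) = (\<lambda>y. J f y - J h y)"
  using J_add[OF _ V_scale, of f h "-1"] J_scale[of h "-1"] by simp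

lemma V_divide: "f \<in> V \<Longrightarrow> (\<lambda>x. f x / c) \<in> V"
  using V_scale[of f "inverse c"] by (simp add: field_simps)

lemma J_divide: "f \<in> V \<Longrightarrow> J (\<lambda>x. f x / c) = (\<lambda>y. J f y / c)"
  using J_scale[of f "inverse c"] by (simp add: field_simps)

lemma banach_transport:
  assumes "banach_on V N"
  shows "banach_on W (\<lambda>u. N (I u))"
proof -
  interpret inv: linear_bijection W V I J by (rule inverse)
  have zero: "I u = (\<lambda>_. 0) \<longleftrightarrow> u = (\<lambda>_. 0)" if "u \<in> W" for u
    using J_I[OF that] J_zero inv.J_zero by metis
  have "norm_on W (\<lambda>u. N (I u))"
    using assms I_in zero by (auto simp: banach_on_def norm_on_def I_add I_scale)
  moreover have "\<exists>u\<in>W. (\<lambda>n. N (I (\<lambda>y. F n y - u y))) \<longlonglongrightarrow> 0"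
    if F: "\<And>n. F n \<in> W" and cauchy: "\<forall>e>0. \<exists>M. \<forall>m\<ge>M. \<forall>n\<ge>M. N (I (\<lambda>y. F m y - F n y)) < e" for F
  proof -
    have "\<forall>e>0. \<exists>M. \<forall>m\<ge>M. \<forall>n\<ge>M. N (\<lambda>x. I (F m) x - I (F n) x) < e"
      using cauchy F by (simp add: inv.J_diff)
    from banach_on_complete[OF assms I_in[OF F] this]
    obtain f where f: "f \<in> V" "(\<lambda>n. N (\<lambda>x. I (F n) x - f x)) \<longlonglongrightarrow> 0"
      by blast
    then show ?thesis
      using F by (intro bexI[of _ "J f"]) (auto simp: inv.J_diff J_in)
  qed
  ultimately show ?thesis
    using W_subspace by (auto simp: banach_on_def)
qed

lemma generates_transport:
  assumes gen: "generates V N D A S"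
  shows "generates W (\<lambda>u. N (I u)) (J ` D) (\<lambda>u. J (A (I u))) (\<lambda>t u. J (S t (I u)))"
proof -
  interpret inv: linear_bijection W V I J by (rule inverse)
  have C0: "C0_semigroup V N S"
    and graph: "generator_graph V N S f h \<longleftrightarrow> f \<in> D \<and> h = A f" for f h
    using gen by (auto simp: generates_def)
  have bdd: "bounded_operator_on V N (S t)" if "0 \<le> t" for t
    using C0 that by (simp add: C0_semigroup_def strongly_continuous_on_def)
  have SV: "S t f \<in> V" if "0 \<le> t" "f \<in> V" for t f
    using bdd that by (simp add: bounded_operator_on_def)
  have "bounded_operator_on W (\<lambda>u. N (I u)) (\<lambda>u. J (S t (I u)))" if t: "0 \<le> t" for t
  proof -
    obtain C where "\<And>f. f \<in> V \<Longrightarrow> N (S t f) \<le> C * N f"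
      using bdd[OF t] unfolding bounded_operator_on_def by blast
    then have "\<forall>u\<in>W. N (I (J (S t (I u)))) \<le> C * N (I u)"
      by (simp add: I_in SV t)
    then show ?thesis
      using bdd[OF t] SV[OF t] I_in
      by (auto simp: bounded_operator_on_def J_in I_add I_scale J_add J_scale)
  qed
  moreover have "((\<lambda>t. N (I (\<lambda>y. J (S t (I u)) y - u y))) \<longlongrightarrow> 0) (at_right 0)" if u: "u \<in> W" for u
  proof -
    have "((\<lambda>t. N (\<lambda>x. S t (I u) x - I u x)) \<longlongrightarrow> 0) (at_right 0)"
      using C0 I_in[OF u] by (simp add: C0_semigroup_def strongly_continuous_on_def)
    then show ?thesis
    proof (rule Lim_transform_eventually)
      show "\<forall>\<^sub>F t in at_right 0. N (\<lambda>x. S t (I u) x - I u x) = N (I (\<lambda>y. J (S t (I u)) y - u y))"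
        using u by (auto simp: eventually_at_filter inv.J_diff J_in SV I_in)
    qed
  qed
  ultimately have "C0_semigroup W (\<lambda>u. N (I u)) (\<lambda>t u. J (S t (I u)))"
    using C0 by (auto simp: C0_semigroup_def strongly_continuous_on_def I_in J_I SV)
  moreover have "generator_graph W (\<lambda>u. N (I u)) (\<lambda>t u. J (S t (I u))) u v
      \<longleftrightarrow> u \<in> J ` D \<and> v = J (A (I u))" for u v
  proof -
    have "generator_graph W (\<lambda>u. N (I u)) (\<lambda>t u. J (S t (I u))) u v
        \<longleftrightarrow> u \<in> W \<and> v \<in> W \<and> generator_graph V N S (I u) (I v)"
    proof (cases "u \<in> W \<and> v \<in> W")
      case True
      then have "\<forall>\<^sub>F t in at_right 0. N (I (\<lambda>y. (J (S t (I u)) y - u y) / of_real t - v y))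
          = N (\<lambda>x. (S t (I u) x - I u x) / of_real t - I v x)"
        by (auto simp: eventually_at_filter inv.J_diff inv.J_divide inv.V_diff inv.V_divide J_in SV I_in)
      from tendsto_cong[OF this] show ?thesis
        using True by (simp add: generator_graph_def I_in)
    qed (auto simp: generator_graph_def)
    also have "\<dots> \<longleftrightarrow> u \<in> J ` D \<and> v = J (A (I u))"
    proof
      assume "u \<in> W \<and> v \<in> W \<and> generator_graph V N S (I u) (I v)"
      then show "u \<in> J ` D \<and> v = J (A (I u))"
        using graph J_I by (metis imageI)
    next
      assume *: "u \<in> J ` D \<and> v = J (A (I u))"
      then obtain f where f: "f \<in> D" "u = J f" by blast
      then have g: "generator_graph V N S f (A f)" using graph by blast
      then have "f \<in> V" "A f \<in> V" by (auto simp: generator_graph_def)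
      then show "u \<in> W \<and> v \<in> W \<and> generator_graph V N S (I u) (I v)"
        using f * g by (simp add: J_in)
    qed
    finally show ?thesis .
  qed
  ultimately show ?thesis
    by (simp add: generates_def)
qed

end

section \<open>Semiflows and weighted composition operators\<close>

text \<open>
  All holomorphic self-maps of a bounded domain share a Lipschitz constant near a given point, since
  Cauchy's inequality bounds their derivatives by the size of the domain.
\<close>

lemma equi_Lipschitz:
  assumes "open \<Omega>" "bounded \<Omega>" "z \<in> \<Omega>"
  obtains L \<rho> where "0 < \<rho>" "ball z \<rho> \<subseteq> \<Omega>"
    "\<And>f w. f holomorphic_on \<Omega> \<Longrightarrow> f ` \<Omega> \<subseteq> \<Omega> \<Longrightarrow> w \<in> ball z \<rho> \<Longrightarrow> cmod (f w - f z) \<le> L * cmod (w - z)"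
proof -
  obtain R where R: "\<And>w. w \<in> \<Omega> \<Longrightarrow> cmod w \<le> R"
    using \<open>bounded \<Omega>\<close> by (auto simp: bounded_iff)
  obtain e where e: "e > 0" "cball z e \<subseteq> \<Omega>"
    using assms open_contains_cball by blast
  define \<rho> where "\<rho> = e / 2"
  have \<rho>: "\<rho> > 0" using e by (simp add: \<rho>_def)
  have sub: "cball w \<rho> \<subseteq> \<Omega>" if "w \<in> ball z \<rho>" for w
  proof
    fix x assume "x \<in> cball w \<rho>"
    then have "x \<in> cball z e"
      using that dist_triangle[of z x w] by (simp add: \<rho>_def)
    then show "x \<in> \<Omega>" using e by blast
  qed
  show thesis
  proof
    show "0 < \<rho>" by fact
    show "ball z \<rho> \<subseteq> \<Omega>" using sub \<rho> by fastforce
    fix f w assume f: "f holomorphic_on \<Omega>" "f ` \<Omega> \<subseteq> \<Omega>" and w: "w \<in> ball z \<rho>"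
    show "cmod (f w - f z) \<le> (R / \<rho>) * cmod (w - z)"
    proof (rule field_differentiable_bound)
      fix x assume x: "x \<in> ball z \<rho>"
      have x\<Omega>: "x \<in> \<Omega>" using sub[OF x] \<rho> by auto
      show "(f has_field_derivative deriv f x) (at x within ball z \<rho>)"
        using holomorphic_derivI[OF f(1) \<open>open \<Omega>\<close> x\<Omega>] by (rule has_field_derivative_at_within)
      have "cmod ((deriv ^^ 1) f x) \<le> fact 1 * R / \<rho> ^ 1"
      proof (rule Cauchy_inequality)
        show "f holomorphic_on ball x \<rho>"
          using holomorphic_on_subset[OF f(1)] sub[OF x] ball_subset_cball by blast
        show "continuous_on (cball x \<rho>) f"
          using holomorphic_on_imp_continuous_on[OF f(1)] continuous_on_subset sub[OF x] by blast
        show "cmod (f y) \<le> R" if "cmod (x - y) = \<rho>" for y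
          using that sub[OF x] f(2) R by (fastforce simp: dist_norm)
      qed (rule \<rho>)
      then show "cmod (deriv f x) \<le> R / \<rho>" by simp
    qed (use w \<rho> in auto)
  qed
qed

lemma semiflow_add:
  assumes "holomorphic_semiflow \<Omega> \<phi>" "0 \<le> s" "0 \<le> t" "z \<in> \<Omega>"
  shows "\<phi> (s + t) z = \<phi> s (\<phi> t z)"
proof -
  have "\<phi> t z \<in> \<Omega>" using assms by (auto simp: holomorphic_semiflow_def)
  then show ?thesis
    using assms by (cases "s = 0"; cases "t = 0") (auto simp: holomorphic_semiflow_def)
qed

text \<open>
  A semiflow is only assumed to be continuous from the right at \<open>0\<close>. Writing the later of
  \<open>\<phi> s z\<close> and \<open>\<phi> t z\<close> as the image of \<open>\<phi> \<bar>s - t\<bar> z\<close> under the flow map of the earlier time, the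
  common Lipschitz constant of the flow maps near \<open>z\<close> gives continuity from both sides.
\<close>

lemma semiflow_continuous:
  assumes \<phi>: "holomorphic_semiflow \<Omega> \<phi>" and \<Omega>: "open \<Omega>" "bounded \<Omega>" and z: "z \<in> \<Omega>"
  shows "continuous_on {0..} (\<lambda>t. \<phi> t z)"
  unfolding continuous_on
proof
  fix t :: real assume "t \<in> {0..}"
  then have t: "0 \<le> t" by simp
  obtain L \<rho> where \<rho>: "0 < \<rho>" "ball z \<rho> \<subseteq> \<Omega>"
    and L: "\<And>f w. f holomorphic_on \<Omega> \<Longrightarrow> f ` \<Omega> \<subseteq> \<Omega> \<Longrightarrow> w \<in> ball z \<rho> \<Longrightarrow>
      cmod (f w - f z) \<le> L * cmod (w - z)"
    using equi_Lipschitz[OF \<Omega> z] by metis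
  have "((\<lambda>h. \<phi> h z) \<longlongrightarrow> z) (at_right 0)"
    using \<phi> z by (simp add: holomorphic_semiflow_def)
  then have lim: "((\<lambda>s. \<phi> \<bar>s - t\<bar> z) \<longlongrightarrow> z) (at t within {0..})"
    by (rule filterlim_compose[OF _ filterlim_abs_diff_at_right])
  have le: "cmod (\<phi> s z - \<phi> t z) \<le> L * cmod (\<phi> \<bar>s - t\<bar> z - z)"
    if s: "0 \<le> s" and near: "\<phi> \<bar>s - t\<bar> z \<in> ball z \<rho>" for s
  proof -
    define m where "m = min s t"
    have m: "0 \<le> m" using s t by (simp add: m_def)
    have split: "\<phi> (max s t) z = \<phi> m (\<phi> \<bar>s - t\<bar> z)"
      using semiflow_add[OF \<phi> m abs_ge_zero z, of "s - t"] by (simp add: m_def max_def min_def abs_if split: if_splits)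
    have "cmod (\<phi> s z - \<phi> t z) = cmod (\<phi> (max s t) z - \<phi> m z)"
      by (auto simp: m_def max_def min_def norm_minus_commute)
    also have "\<dots> \<le> L * cmod (\<phi> \<bar>s - t\<bar> z - z)"
      unfolding split using \<phi> m near by (intro L) (auto simp: holomorphic_semiflow_def)
    finally show ?thesis .
  qed
  have "\<forall>\<^sub>F s in at t within {0..}. \<phi> \<bar>s - t\<bar> z \<in> ball z \<rho>"
    using lim \<rho>(1) by (intro topological_tendstoD) auto
  moreover have "\<forall>\<^sub>F s in at t within {0..}. 0 \<le> s"
    by (auto simp: eventually_at_filter)
  ultimately have ev: "\<forall>\<^sub>F s in at t within {0..}. norm (\<phi> s z - \<phi> t z) \<le> L * cmod (\<phi> \<bar>s - t\<bar> z - z)"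
    by eventually_elim (rule le)
  have "((\<lambda>s. L * cmod (\<phi> \<bar>s - t\<bar> z - z)) \<longlongrightarrow> L * cmod (z - z)) (at t within {0..})"
    by (intro tendsto_intros lim)
  then have "((\<lambda>s. \<phi> s z - \<phi> t z) \<longlongrightarrow> 0) (at t within {0..})"
    by (intro Lim_null_comparison[OF ev]) simp
  then show "((\<lambda>s. \<phi> s z) \<longlongrightarrow> \<phi> t z) (at t within {0..})"
    by (rule LIM_zero_cancel)
qed

text \<open>
  Continuity of the trajectory makes \<open>r \<mapsto> g (\<phi> r z)\<close> integrable, so the integral over
  \<open>[0, s + t]\<close> may be split at \<open>t\<close>; the second part is the weight at the point \<open>\<phi> t z\<close>.
\<close>

lemma weight_cocycle:
  assumes \<phi>: "holomorphic_semiflow \<Omega> \<phi>" and \<Omega>: "open \<Omega>" "bounded \<Omega>"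
    and g: "continuous_on \<Omega> g" and z: "z \<in> \<Omega>" and st: "0 \<le> s" "0 \<le> t"
  shows "weight \<phi> g (s + t) z = weight \<phi> g t z * weight \<phi> g s (\<phi> t z)"
proof -
  have in\<Omega>: "\<phi> r z \<in> \<Omega>" if "0 \<le> r" for r
    using \<phi> z that by (auto simp: holomorphic_semiflow_def)
  have "continuous_on {0..s + t} (\<lambda>r. g (\<phi> r z))"
    by (rule continuous_on_compose2[OF g continuous_on_subset[OF semiflow_continuous[OF \<phi> \<Omega> z]]])
      (auto intro: in\<Omega>)
  then have "integral {0..s + t} (\<lambda>r. g (\<phi> r z))
      = integral {0..t} (\<lambda>r. g (\<phi> r z)) + integral {t..s + t} (\<lambda>r. g (\<phi> r z))"
    using st by (intro Henstock_Kurzweil_Integration.integral_combine[symmetric] integrable_continuous_real) auto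
  also have "integral {t..s + t} (\<lambda>r. g (\<phi> r z)) = integral {0..s} (\<lambda>r. g (\<phi> (r + t) z))"
    using integral_shift_Icc_real[of 0 s "\<lambda>r. g (\<phi> r z)" t] by (simp add: add.commute o_def)
  also have "\<dots> = integral {0..s} (\<lambda>r. g (\<phi> r (\<phi> t z)))"
    using st z by (intro integral_cong) (simp add: semiflow_add[OF \<phi>])
  finally show ?thesis
    by (simp add: weight_def exp_add)
qed

lemma weighted_composition_semigroup:
  assumes \<phi>: "holomorphic_semiflow \<Omega> \<phi>" and \<Omega>: "open \<Omega>" "bounded \<Omega>"
    and g: "continuous_on \<Omega> g"
    and X: "function_space_on \<Omega> X" and adm: "admissible \<Omega> \<phi> g X N"
  shows "C0_semigroup X N (weighted_composition \<Omega> \<phi> g)"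
proof -
  have "weighted_composition \<Omega> \<phi> g 0 f = f" if "f \<in> X" for f
    using X \<phi> that by (auto simp: weighted_composition_def weight_def fun_eq_iff
        function_space_on_def holomorphic_semiflow_def)
  moreover have "weighted_composition \<Omega> \<phi> g (s + t) f
      = weighted_composition \<Omega> \<phi> g s (weighted_composition \<Omega> \<phi> g t f)"
    if st: "0 \<le> s" "0 \<le> t" for s t f
  proof
    fix z
    show "weighted_composition \<Omega> \<phi> g (s + t) f z
      = weighted_composition \<Omega> \<phi> g s (weighted_composition \<Omega> \<phi> g t f) z"
    proof (cases "z \<in> \<Omega>")
      case True
      then have "\<phi> s z \<in> \<Omega>" using \<phi> st by (auto simp: holomorphic_semiflow_def)
      then show ?thesis
        using True st weight_cocycle[OF \<phi> \<Omega> g True st(2,1)] semiflow_add[OF \<phi> st(2,1) True]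
        by (simp add: weighted_composition_def add.commute)
    qed (simp add: weighted_composition_def)
  qed
  ultimately show ?thesis
    using adm by (simp add: C0_semigroup_def admissible_def)
qed

section \<open>Linearity of the trace\<close>

lemma boundary_integral_tendsto:
  assumes "has_boundary_distribution \<Omega> k f" "\<psi> \<in> boundary_test_functions \<Omega>"
  shows "((\<lambda>r. LINT x:frontier \<Omega>|arc_length. dilate \<Omega> k f r x * \<psi> x)
    \<longlongrightarrow> boundary_trace \<Omega> k f \<psi>) (at_left 1)"
proof -
  obtain L where L: "((\<lambda>r. LINT x:frontier \<Omega>|arc_length. dilate \<Omega> k f r x * \<psi> x) \<longlongrightarrow> L) (at_left 1)"
    using assms unfolding has_boundary_distribution_def by blast
  then show ?thesis
    using assms(2) tendsto_Lim[OF trivial_limit_at_left_real L] by (simp add: boundary_trace_def)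
qed

lemma boundary_trace_add:
  assumes f: "has_boundary_distribution \<Omega> k f" and h: "has_boundary_distribution \<Omega> k h"
  shows "boundary_trace \<Omega> k (\<lambda>z. f z + h z) = (\<lambda>\<psi>. boundary_trace \<Omega> k f \<psi> + boundary_trace \<Omega> k h \<psi>)"
proof
  fix \<psi>
  show "boundary_trace \<Omega> k (\<lambda>z. f z + h z) \<psi> = boundary_trace \<Omega> k f \<psi> + boundary_trace \<Omega> k h \<psi>"
  proof (cases "\<psi> \<in> boundary_test_functions \<Omega>")
    case True
    let ?I = "\<lambda>f r. LINT x:frontier \<Omega>|arc_length. dilate \<Omega> k f r x * \<psi> x"
    have "((\<lambda>r. ?I f r + ?I h r) \<longlongrightarrow> boundary_trace \<Omega> k f \<psi> + boundary_trace \<Omega> k h \<psi>) (at_left 1)"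
      by (intro tendsto_add boundary_integral_tendsto f h True)
    moreover have "\<forall>\<^sub>F r in at_left 1. ?I f r + ?I h r = ?I (\<lambda>z. f z + h z) r"
      using eventually_at_left_real[of 0 1, simplified]
    proof eventually_elim
      case (elim r)
      have "?I f r + ?I h r
          = (LINT x:frontier \<Omega>|arc_length. dilate \<Omega> k f r x * \<psi> x + dilate \<Omega> k h r x * \<psi> x)"
        using f h True elim
        by (intro set_integral_add(2)[symmetric]) (auto simp: has_boundary_distribution_def)
      then show ?case by (simp add: dilate_def algebra_simps)
    qed
    ultimately have "(?I (\<lambda>z. f z + h z) \<longlongrightarrow> boundary_trace \<Omega> k f \<psi> + boundary_trace \<Omega> k h \<psi>) (at_left 1)"
      by (rule Lim_transform_eventually)
    from tendsto_Lim[OF trivial_limit_at_left_real this] show ?thesis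
      using True by (simp add: boundary_trace_def)
  qed (simp add: boundary_trace_def)
qed

lemma boundary_trace_scale:
  assumes f: "has_boundary_distribution \<Omega> k f"
  shows "boundary_trace \<Omega> k (\<lambda>z. c * f z) = (\<lambda>\<psi>. c * boundary_trace \<Omega> k f \<psi>)"
proof
  fix \<psi>
  show "boundary_trace \<Omega> k (\<lambda>z. c * f z) \<psi> = c * boundary_trace \<Omega> k f \<psi>"
  proof (cases "\<psi> \<in> boundary_test_functions \<Omega>")
    case True
    let ?I = "\<lambda>f r. LINT x:frontier \<Omega>|arc_length. dilate \<Omega> k f r x * \<psi> x"
    have "((\<lambda>r. c * ?I f r) \<longlongrightarrow> c * boundary_trace \<Omega> k f \<psi>) (at_left 1)"
      by (intro tendsto_mult tendsto_const boundary_integral_tendsto f True)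
    moreover have "c * ?I f r = ?I (\<lambda>z. c * f z) r" for r
      by (simp add: dilate_def mult.assoc)
    ultimately have "(?I (\<lambda>z. c * f z) \<longlongrightarrow> c * boundary_trace \<Omega> k f \<psi>) (at_left 1)"
      by simp
    from tendsto_Lim[OF trivial_limit_at_left_real this] show ?thesis
      using True by (simp add: boundary_trace_def)
  qed (simp add: boundary_trace_def)
qed

lemma trace_linear_bijection:
  assumes X: "complex_subspace X" and bs: "has_boundary_space \<Omega> k X"
  shows "linear_bijection X (boundary_space \<Omega> k X) (boundary_trace \<Omega> k) (trace_inv \<Omega> k X)"
proof
  show "trace_inv \<Omega> k X (boundary_trace \<Omega> k f) = f" if "f \<in> X" for f
    using bs that unfolding has_boundary_space_def trace_inv_def
    by (intro the_inv_into_f_f) (auto simp: bij_betw_def)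
  have dist: "has_boundary_distribution \<Omega> k f" if "f \<in> X" for f
    using bs that by (simp add: has_boundary_space_def)
  show "boundary_trace \<Omega> k (\<lambda>x. f x + h x) = (\<lambda>\<psi>. boundary_trace \<Omega> k f \<psi> + boundary_trace \<Omega> k h \<psi>)"
    if "f \<in> X" "h \<in> X" for f h
    using that by (intro boundary_trace_add dist)
  show "boundary_trace \<Omega> k (\<lambda>x. c * f x) = (\<lambda>\<psi>. c * boundary_trace \<Omega> k f \<psi>)" if "f \<in> X" for c f
    using that by (intro boundary_trace_scale dist)
  show "boundary_space \<Omega> k X = boundary_trace \<Omega> k ` X"
    by (rule boundary_space_def)
qed (rule X)

section \<open>The Dirichlet-to-Robin evolution problem\<close>

theorem theorem3p1:
  fixes \<Omega> :: "complex set"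
    and \<phi> :: "real \<Rightarrow> complex \<Rightarrow> complex"
    and G g k :: "complex \<Rightarrow> complex"
    and X :: "(complex \<Rightarrow> complex) set"
    and N :: "(complex \<Rightarrow> complex) \<Rightarrow> real"
  assumes "jordan_domain \<Omega>"
    and "holomorphic_semiflow \<Omega> \<phi>"
    and "semiflow_generator \<Omega> \<phi> G"
    and "g holomorphic_on \<Omega>"
    and "function_space_on \<Omega> X"
    and "banach_on X N"
    and "admissible \<Omega> \<phi> g X N"
    and generator_acts:
      "\<And>f h. generator_graph X N (weighted_composition \<Omega> \<phi> g) f h \<Longrightarrow> h = robin \<Omega> g G f"
    and "conformal_onto_disk \<Omega> k"
    and "has_boundary_space \<Omega> k X"
  shows "\<exists>T. well_posed_with (boundary_space \<Omega> k X) (boundary_norm \<Omega> k X N)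
               (dtr_dom \<Omega> k \<phi> g X N) (dtr \<Omega> k g G X) T \<and>
             (\<forall>u\<^sub>0\<in>boundary_space \<Omega> k X. \<forall>t\<ge>0.
                T t u\<^sub>0 = boundary_trace \<Omega> k (weighted_composition \<Omega> \<phi> g t (trace_inv \<Omega> k X u\<^sub>0)))"
proof -
  have \<Omega>: "open \<Omega>" "bounded \<Omega>"
    using assms(1) Jordan_inside_outside unfolding jordan_domain_def by blast+
  let ?S = "weighted_composition \<Omega> \<phi> g"
  let ?J = "boundary_trace \<Omega> k" and ?I = "trace_inv \<Omega> k X"
  have "C0_semigroup X N ?S"
    using assms(2) \<Omega> holomorphic_on_imp_continuous_on[OF assms(4)] assms(5,7)
    by (rule weighted_composition_semigroup)
  then have gen: "generates X N (generator_dom X N ?S) (robin \<Omega> g G) ?S"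
    using generator_acts by (rule generates_generator_dom)
  have "complex_subspace X"
    using assms(6) by (simp add: banach_on_def)
  then interpret linear_bijection X "boundary_space \<Omega> k X" ?J ?I
    using assms(10) by (rule trace_linear_bijection)
  have "well_posed_with (boundary_space \<Omega> k X) (\<lambda>u. N (?I u)) (?J ` generator_dom X N ?S)
      (\<lambda>u. ?J (robin \<Omega> g G (?I u))) (\<lambda>t u. ?J (?S t (?I u)))"
    by (rule generates_imp_well_posed[OF banach_transport[OF assms(6)] generates_transport[OF gen]])
  moreover have "boundary_norm \<Omega> k X N = (\<lambda>u. N (?I u))"
    by (simp add: fun_eq_iff boundary_norm_def)
  moreover have "dtr \<Omega> k g G X = (\<lambda>u. ?J (robin \<Omega> g G (?I u)))"
    by (simp add: fun_eq_iff dtr_def)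
  ultimately show ?thesis
    by (intro exI[of _ "\<lambda>t u. ?J (?S t (?I u))"]) (simp add: dtr_dom_def)
qed

end
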